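(* Let $\mathbb{K}$ be a field of characteristic $0$. Suppose that $\mathcal{A}$ is a $2n$-dimensional Poincaré CDGA over $\mathbb{K}$ which is formal and connected. Let $\omega\in\mathcal{A}^{2n}$ be such that $[\omega]$ is the dual of the Poincaré class. Let $\theta$ be a new element of degree $2n-1$ and $\mathcal{A}_\theta=\mathcal{A}\otimes\Lambda\theta$ with $d\theta=\omega$. If $\mathcal{A}_\theta$ is formal, then $H^*(\mathcal{A})\cong\mathbb{K}[x]/(x^p)$ is a quotient of the polynomial ring in a single (homogeneous) variable.
   Context: A finite-dimensional graded commutative algebra $H$ is $m$-dimensional Poincaré if there exists $\alpha_H\in(H^m)^\vee$ (the Poincaré class) such that $H^i\to(H^{m-i})^\vee$, $x\mapsto(y\mapsto\alpha_H(xy))$, is an isomorphism for all $i$; a CDGA is Poincaré if its cohomology is. The dual of the Poincaré class is the top-degree class $c$ with $\alpha_H(c)=1$. Connected means $H^0(\mathcal{A})=\mathbb{K}$ (with $\mathcal{A}$ non-negatively graded). $\mathcal{A}_\theta=\{x+\theta y:x,y\in\mathcal{A}\}$. A CDGA is formal if it is connected to its cohomology by a zigzag of quasi-isomorphisms. *)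

theory Defs
  imports "HOL-Computational_Algebra.Polynomial" "HOL-Library.FuncSet"
begin

text \<open>A (non-negatively) graded CDGA over a field 'k, encoded degree-wise:
  cgr i is the degree-i component (a set of elements of type 'a), and all operations
  are given degree-wise (addition, zero and scalar multiplication on each component,
  bilinear products cgr i x cgr j -> cgr (i+j), differential cgr i -> cgr (i+1)).\<close>

record ('k,'a) cdga =
  cgr :: "nat \<Rightarrow> 'a set"
  czr :: "nat \<Rightarrow> 'a"
  cad :: "nat \<Rightarrow> 'a \<Rightarrow> 'a \<Rightarrow> 'a"
  csc :: "nat \<Rightarrow> 'k \<Rightarrow> 'a \<Rightarrow> 'a"
  cmu :: "nat \<Rightarrow> nat \<Rightarrow> 'a \<Rightarrow> 'a \<Rightarrow> 'a"
  cun :: 'a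
  cdf :: "nat \<Rightarrow> 'a \<Rightarrow> 'a"

definition is_vs :: "('k::field,'a) cdga \<Rightarrow> nat \<Rightarrow> bool" where
  "is_vs C i \<longleftrightarrow> (let V = cgr C i; z = czr C i; a = cad C i; s = csc C i in
     z \<in> V \<and> (\<forall>x\<in>V. \<forall>y\<in>V. a x y \<in> V) \<and> (\<forall>c. \<forall>x\<in>V. s c x \<in> V) \<and>
     (\<forall>x\<in>V. \<forall>y\<in>V. \<forall>w\<in>V. a (a x y) w = a x (a y w)) \<and>
     (\<forall>x\<in>V. \<forall>y\<in>V. a x y = a y x) \<and>
     (\<forall>x\<in>V. a x z = x) \<and> (\<forall>x\<in>V. \<exists>y\<in>V. a x y = z) \<and>
     (\<forall>x\<in>V. s 1 x = x) \<and>
     (\<forall>c e. \<forall>x\<in>V. s (c * e) x = s c (s e x)) \<and>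
     (\<forall>c. \<forall>x\<in>V. \<forall>y\<in>V. s c (a x y) = a (s c x) (s c y)) \<and>
     (\<forall>c e. \<forall>x\<in>V. s (c + e) x = a (s c x) (s e x)))"

definition is_cdga :: "('k::field,'a) cdga \<Rightarrow> bool" where
  "is_cdga C \<longleftrightarrow>
     (\<forall>i. is_vs C i) \<and>
     (\<forall>i j. \<forall>x\<in>cgr C i. \<forall>y\<in>cgr C j. cmu C i j x y \<in> cgr C (i+j)) \<and>
     (\<forall>i j. \<forall>x\<in>cgr C i. \<forall>x'\<in>cgr C i. \<forall>y\<in>cgr C j.
        cmu C i j (cad C i x x') y = cad C (i+j) (cmu C i j x y) (cmu C i j x' y)) \<and>
     (\<forall>i j. \<forall>x\<in>cgr C i. \<forall>y\<in>cgr C j. \<forall>y'\<in>cgr C j.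
        cmu C i j x (cad C j y y') = cad C (i+j) (cmu C i j x y) (cmu C i j x y')) \<and>
     (\<forall>i j c. \<forall>x\<in>cgr C i. \<forall>y\<in>cgr C j.
        cmu C i j (csc C i c x) y = csc C (i+j) c (cmu C i j x y) \<and>
        cmu C i j x (csc C j c y) = csc C (i+j) c (cmu C i j x y)) \<and>
     cun C \<in> cgr C 0 \<and>
     (\<forall>i. \<forall>x\<in>cgr C i. cmu C 0 i (cun C) x = x \<and> cmu C i 0 x (cun C) = x) \<and>
     (\<forall>i j k. \<forall>x\<in>cgr C i. \<forall>y\<in>cgr C j. \<forall>z\<in>cgr C k.
        cmu C (i+j) k (cmu C i j x y) z = cmu C i (j+k) x (cmu C j k y z)) \<and>
     (\<forall>i j. \<forall>x\<in>cgr C i. \<forall>y\<in>cgr C j.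
        cmu C i j x y = csc C (i+j) ((-1) ^ (i*j)) (cmu C j i y x)) \<and>
     (\<forall>i. \<forall>x\<in>cgr C i. cdf C i x \<in> cgr C (Suc i)) \<and>
     (\<forall>i. \<forall>x\<in>cgr C i. \<forall>y\<in>cgr C i.
        cdf C i (cad C i x y) = cad C (Suc i) (cdf C i x) (cdf C i y)) \<and>
     (\<forall>i c. \<forall>x\<in>cgr C i. cdf C i (csc C i c x) = csc C (Suc i) c (cdf C i x)) \<and>
     (\<forall>i. \<forall>x\<in>cgr C i. cdf C (Suc i) (cdf C i x) = czr C (Suc (Suc i))) \<and>
     (\<forall>i j. \<forall>x\<in>cgr C i. \<forall>y\<in>cgr C j.
        cdf C (i+j) (cmu C i j x y) =
          cad C (Suc (i+j)) (cmu C (Suc i) j (cdf C i x) y)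
                            (csc C (Suc (i+j)) ((-1) ^ i) (cmu C i (Suc j) x (cdf C j y))))"

definition is_hom :: "('k::field,'a) cdga \<Rightarrow> ('k,'b) cdga \<Rightarrow> (nat \<Rightarrow> 'a \<Rightarrow> 'b) \<Rightarrow> bool" where
  "is_hom C D f \<longleftrightarrow>
     (\<forall>i. \<forall>x\<in>cgr C i. f i x \<in> cgr D i) \<and>
     (\<forall>i. \<forall>x\<in>cgr C i. \<forall>y\<in>cgr C i. f i (cad C i x y) = cad D i (f i x) (f i y)) \<and>
     (\<forall>i c. \<forall>x\<in>cgr C i. f i (csc C i c x) = csc D i c (f i x)) \<and>
     (\<forall>i j. \<forall>x\<in>cgr C i. \<forall>y\<in>cgr C j. f (i+j) (cmu C i j x y) = cmu D i j (f i x) (f j y)) \<and>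
     f 0 (cun C) = cun D \<and>
     (\<forall>i. \<forall>x\<in>cgr C i. f (Suc i) (cdf C i x) = cdf D i (f i x))"

definition cocycles :: "('k,'a) cdga \<Rightarrow> nat \<Rightarrow> 'a set" where
  "cocycles C i = {x \<in> cgr C i. cdf C i x = czr C (Suc i)}"

definition coboundaries :: "('k,'a) cdga \<Rightarrow> nat \<Rightarrow> 'a set" where
  "coboundaries C i = (if i = 0 then {czr C 0} else cdf C (i - 1) ` cgr C (i - 1))"

definition coset :: "('k,'a) cdga \<Rightarrow> nat \<Rightarrow> 'a \<Rightarrow> 'a set" where
  "coset C i x = {cad C i x b | b. b \<in> coboundaries C i}"

definition rep :: "'a set \<Rightarrow> 'a" where
  "rep X = (SOME x. x \<in> X)"

definition cohom :: "('k,'a) cdga \<Rightarrow> ('k,'a set) cdga" where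
  "cohom C = \<lparr> cgr = (\<lambda>i. coset C i ` cocycles C i),
               czr = (\<lambda>i. coset C i (czr C i)),
               cad = (\<lambda>i X Y. coset C i (cad C i (rep X) (rep Y))),
               csc = (\<lambda>i c X. coset C i (csc C i c (rep X))),
               cmu = (\<lambda>i j X Y. coset C (i+j) (cmu C i j (rep X) (rep Y))),
               cun = coset C 0 (cun C),
               cdf = (\<lambda>i X. coset C (Suc i) (czr C (Suc i))) \<rparr>"

definition quasi_iso :: "('k::field,'a) cdga \<Rightarrow> ('k,'b) cdga \<Rightarrow> (nat \<Rightarrow> 'a \<Rightarrow> 'b) \<Rightarrow> bool" where
  "quasi_iso C D f \<longleftrightarrow> is_hom C D f \<and>
     (\<forall>i. bij_betw (\<lambda>X. coset D i (f i (rep X))) (cgr (cohom C) i) (cgr (cohom D) i))"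

definition qrel :: "('k::field,'a) cdga \<Rightarrow> ('k,'b) cdga \<Rightarrow> bool" where
  "qrel C D \<longleftrightarrow> (\<exists>f. quasi_iso C D f) \<or> (\<exists>g. quasi_iso D C g)"

definition formal :: "'c itself \<Rightarrow> ('k::field,'a) cdga \<Rightarrow> bool" where
  "formal T C \<longleftrightarrow> (\<exists>(Z :: nat \<Rightarrow> ('k,'c) cdga) N.
      (\<forall>k\<le>N. is_cdga (Z k)) \<and> qrel C (Z 0) \<and>
      (\<forall>k<N. qrel (Z k) (Z (Suc k))) \<and> qrel (Z N) (cohom C))"

definition one_dim :: "('k::field,'a) cdga \<Rightarrow> nat \<Rightarrow> bool" where
  "one_dim C i \<longleftrightarrow> (\<exists>v\<in>cgr C i. v \<noteq> czr C i \<and> (\<forall>w\<in>cgr C i. \<exists>c. w = csc C i c v))"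

definition connected :: "('k::field,'a) cdga \<Rightarrow> bool" where
  "connected C \<longleftrightarrow> one_dim (cohom C) 0"

fun lincomb :: "('k,'a) cdga \<Rightarrow> nat \<Rightarrow> ('k \<times> 'a) list \<Rightarrow> 'a" where
  "lincomb C i [] = czr C i"
| "lincomb C i ((c, v) # l) = cad C i (csc C i c v) (lincomb C i l)"

definition fin_dim :: "('k,'a) cdga \<Rightarrow> nat \<Rightarrow> bool" where
  "fin_dim C i \<longleftrightarrow> (\<exists>vs. set vs \<subseteq> cgr C i \<and>
      (\<forall>x\<in>cgr C i. \<exists>cs. length cs = length vs \<and> x = lincomb C i (zip cs vs)))"

definition lin_fun :: "('k::field,'a) cdga \<Rightarrow> nat \<Rightarrow> ('a \<Rightarrow> 'k) \<Rightarrow> bool" where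
  "lin_fun C j \<phi> \<longleftrightarrow> (\<forall>x\<in>cgr C j. \<forall>y\<in>cgr C j. \<phi> (cad C j x y) = \<phi> x + \<phi> y) \<and>
                      (\<forall>c. \<forall>x\<in>cgr C j. \<phi> (csc C j c x) = c * \<phi> x)"

definition dual :: "('k::field,'a) cdga \<Rightarrow> nat \<Rightarrow> ('a \<Rightarrow> 'k) set" where
  "dual C j = {\<phi>. lin_fun C j \<phi> \<and> (\<forall>y. y \<notin> cgr C j \<longrightarrow> \<phi> y = undefined)}"

definition poincare_alg :: "('k::field,'a) cdga \<Rightarrow> nat \<Rightarrow> ('a \<Rightarrow> 'k) \<Rightarrow> bool" where
  "poincare_alg C m \<alpha> \<longleftrightarrow> (\<forall>i. fin_dim C i) \<and> (\<forall>i>m. cgr C i = {czr C i}) \<and>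
     \<alpha> \<in> dual C m \<and>
     (\<forall>i\<le>m. bij_betw (\<lambda>x. restrict (\<lambda>y. \<alpha> (cmu C i (m - i) x y)) (cgr C (m - i)))
                      (cgr C i) (dual C (m - i)))"

text \<open>A_theta = A \<otimes> \<Lambda>theta, |theta| = 2n-1, d theta = \<omega>; elements x + theta y encoded as pairs (x,y).
  In degree i: x \<in> A^i and y \<in> A^(i-(2n-1)) (y is a fixed dummy if i < 2n-1).\<close>
definition theta_ext :: "('k::field,'a) cdga \<Rightarrow> nat \<Rightarrow> 'a \<Rightarrow> ('k, 'a \<times> 'a) cdga" where
  "theta_ext A n \<omega> = (let t = 2*n - 1 in
     \<lparr> cgr = (\<lambda>i. {(x, y). x \<in> cgr A i \<and> (if t \<le> i then y \<in> cgr A (i - t) else y = czr A 0)}),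
       czr = (\<lambda>i. (czr A i, if t \<le> i then czr A (i - t) else czr A 0)),
       cad = (\<lambda>i (x, y) (x', y'). (cad A i x x', if t \<le> i then cad A (i - t) y y' else czr A 0)),
       csc = (\<lambda>i c (x, y). (csc A i c x, if t \<le> i then csc A (i - t) c y else czr A 0)),
       cmu = (\<lambda>i j (x, y) (x', y').
                (cmu A i j x x',
                 if t \<le> i + j then
                   cad A (i + j - t)
                     (if t \<le> i then cmu A (i - t) j y x' else czr A (i + j - t))
                     (if t \<le> j then csc A (i + j - t) ((-1) ^ i) (cmu A i (j - t) x y')
                      else czr A (i + j - t))
                 else czr A 0)),
       cun = (cun A, czr A 0),
       cdf = (\<lambda>i (x, y).
                (cad A (Suc i) (cdf A i x)
                    (if t \<le> i then cmu A (2*n) (i - t) \<omega> y else czr A (Suc i)),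
                 if t \<le> Suc i then
                   (if t \<le> i then csc A (Suc i - t) (-1) (cdf A (i - t) y) else czr A (Suc i - t))
                 else czr A 0)) \<rparr>)"

text \<open>The graded algebra K[x]/(x^p) with x homogeneous of degree k (zero differential):
  degree-d part = span of the x^i with i < p and i*k = d.\<close>
definition ptrunc :: "nat \<Rightarrow> 'k::comm_ring_1 poly \<Rightarrow> 'k poly" where
  "ptrunc p h = (\<Sum>i<p. monom (coeff h i) i)"

definition trunc_poly :: "nat \<Rightarrow> nat \<Rightarrow> ('k::field, 'k poly) cdga" where
  "trunc_poly k p = \<lparr> cgr = (\<lambda>d. {f. \<forall>i. coeff f i \<noteq> 0 \<longrightarrow> i < p \<and> i * k = d}),
                      czr = (\<lambda>_. 0),
                      cad = (\<lambda>_ f g. f + g),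
                      csc = (\<lambda>_ c f. smult c f),
                      cmu = (\<lambda>_ _ f g. ptrunc p (f * g)),
                      cun = 1,
                      cdf = (\<lambda>_ _. 0) \<rparr>"

definition cdga_iso :: "('k::field,'a) cdga \<Rightarrow> ('k,'b) cdga \<Rightarrow> bool" where
  "cdga_iso C D \<longleftrightarrow> (\<exists>f. is_hom C D f \<and> (\<forall>i. bij_betw (f i) (cgr C i) (cgr D i)))"

end

theory Submission
  imports Defs
begin

text \<open>
  Triple Massey products vanish in a formal CDGA. If \<open>[a][b] = [\<omega>]\<close> and \<open>[b][z] = 0\<close> in
  \<open>H\<^sup>*(A)\<close>, then in \<open>A\<^sub>\<theta>\<close> the product \<open>ab\<close> becomes exact, with primitive \<open>\<theta>\<close> up to \<open>A\<close>, and the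
  \<open>\<theta>\<close>-component of \<open>\<langle>a, b, z\<rangle>\<close> is \<open>z\<close> modulo multiples of \<open>a\<close>. Vanishing therefore means that \<open>[z]\<close> is
  divisible by \<open>[a]\<close>, and that \<open>[z] = 0\<close> if \<open>z\<close> and \<open>a\<close> have the same degree. Apply this to a nonzero
  class \<open>x = [a]\<close> of minimal positive degree \<open>k\<close> and a Poincare dual class \<open>y = [b]\<close>: classes of degree
  greater than \<open>k\<close> are killed by \<open>y\<close> for degree reasons, and a class of degree \<open>k\<close> is killed by \<open>y\<close>
  after subtracting a multiple of \<open>x\<close>. By induction on the degree every class is a multiple of a
  power of \<open>x\<close>.
\<close>

section \<open>Degreewise arithmetic, cocycles and coboundaries in a CDGA\<close>

locale gcdga =
  fixes C :: "('k::field, 'a) cdga"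
  assumes cdga: "is_cdga C"
begin

lemma vs: "is_vs C i"
  using cdga unfolding is_cdga_def by meson

lemma zero_closed [simp]: "czr C i \<in> cgr C i"
  using vs[of i] unfolding is_vs_def Let_def by meson

lemma add_closed [simp]: "x \<in> cgr C i \<Longrightarrow> y \<in> cgr C i \<Longrightarrow> cad C i x y \<in> cgr C i"
  using vs[of i] unfolding is_vs_def Let_def by meson

lemma scale_closed [simp]: "x \<in> cgr C i \<Longrightarrow> csc C i c x \<in> cgr C i"
  using vs[of i] unfolding is_vs_def Let_def by meson

lemma add_assoc:
  "\<lbrakk>x \<in> cgr C i; y \<in> cgr C i; w \<in> cgr C i\<rbrakk>
    \<Longrightarrow> cad C i (cad C i x y) w = cad C i x (cad C i y w)"
  using vs[of i] unfolding is_vs_def Let_def by meson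

lemma add_comm: "x \<in> cgr C i \<Longrightarrow> y \<in> cgr C i \<Longrightarrow> cad C i x y = cad C i y x"
  using vs[of i] unfolding is_vs_def Let_def by meson

lemma add_lcomm:
  "\<lbrakk>x \<in> cgr C i; y \<in> cgr C i; w \<in> cgr C i\<rbrakk>
    \<Longrightarrow> cad C i x (cad C i y w) = cad C i y (cad C i x w)"
  by (metis add_assoc add_comm)

lemmas add_ac = add_assoc add_comm add_lcomm

lemma add_zero [simp]: "x \<in> cgr C i \<Longrightarrow> cad C i x (czr C i) = x"
  using vs[of i] unfolding is_vs_def Let_def by meson

lemma zero_add [simp]: "x \<in> cgr C i \<Longrightarrow> cad C i (czr C i) x = x"
  by (metis add_comm add_zero zero_closed)

lemma ex_neg: "x \<in> cgr C i \<Longrightarrow> \<exists>y\<in>cgr C i. cad C i x y = czr C i"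
  using vs[of i] unfolding is_vs_def Let_def by meson

lemma scale_one [simp]: "x \<in> cgr C i \<Longrightarrow> csc C i 1 x = x"
  using vs[of i] unfolding is_vs_def Let_def by meson

lemma scale_scale [simp]: "x \<in> cgr C i \<Longrightarrow> csc C i c (csc C i e x) = csc C i (c * e) x"
  using vs[of i] unfolding is_vs_def Let_def by metis

lemma scale_add:
  "x \<in> cgr C i \<Longrightarrow> y \<in> cgr C i \<Longrightarrow> csc C i c (cad C i x y) = cad C i (csc C i c x) (csc C i c y)"
  using vs[of i] unfolding is_vs_def Let_def by meson

lemma scale_plus: "x \<in> cgr C i \<Longrightarrow> csc C i (c + e) x = cad C i (csc C i c x) (csc C i e x)"
  using vs[of i] unfolding is_vs_def Let_def by meson

lemma add_cancel:
  assumes "x \<in> cgr C i" "y \<in> cgr C i" "w \<in> cgr C i"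
  shows "cad C i x y = cad C i x w \<longleftrightarrow> y = w"
proof
  assume eq: "cad C i x y = cad C i x w"
  obtain u where u: "u \<in> cgr C i" "cad C i x u = czr C i"
    using ex_neg assms(1) by blast
  have "y = cad C i (cad C i x u) y" using u assms by simp
  also have "\<dots> = cad C i u (cad C i x y)" using u(1) assms by (metis add_assoc add_comm)
  also have "\<dots> = cad C i (cad C i x u) w" using u(1) assms by (metis eq add_assoc add_comm)
  finally show "y = w" using u assms by simp
qed simp

lemma scale_0 [simp]: "x \<in> cgr C i \<Longrightarrow> csc C i 0 x = czr C i"
  using add_cancel[of "csc C i 0 x" i "csc C i 0 x" "czr C i"] scale_plus[of x i 0 0] by simp

lemma scale_zero [simp]: "csc C i c (czr C i) = czr C i"
  using scale_0[of "czr C i" i] scale_scale[of "czr C i" i c 0] by simp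

lemma add_neg [simp]:
  assumes "x \<in> cgr C i"
  shows "cad C i x (csc C i (-1) x) = czr C i" "cad C i (csc C i (-1) x) x = czr C i"
  using scale_plus[OF assms, of 1 "-1"] scale_plus[OF assms, of "-1" 1] assms by simp_all

lemma add_diff_cancel:
  "x \<in> cgr C i \<Longrightarrow> y \<in> cgr C i \<Longrightarrow> cad C i y (cad C i x (csc C i (-1) y)) = x"
  by (simp add: add_lcomm[of y i x])

lemma add_eq_iff:
  assumes "x \<in> cgr C i" "y \<in> cgr C i" "w \<in> cgr C i"
  shows "cad C i x y = w \<longleftrightarrow> x = cad C i w (csc C i (-1) y)"
proof -
  have "cad C i (cad C i x y) (csc C i (-1) y) = x"
    using assms by (simp add: add_assoc)
  moreover have "cad C i (cad C i w (csc C i (-1) y)) y = w"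
    using assms by (simp add: add_assoc)
  ultimately show ?thesis by auto
qed

text \<open>Here and in several rules below the target degree is a separate variable with an
  equation such as \<open>m = i + j\<close>, so that the simplifier can match degrees written in
  different but equal forms.\<close>

lemma mult_closed [simp]:
  "\<lbrakk>x \<in> cgr C i; y \<in> cgr C j; m = i + j\<rbrakk> \<Longrightarrow> cmu C i j x y \<in> cgr C m"
  using cdga unfolding is_cdga_def by meson

lemma mult_add_left:
  "\<lbrakk>x \<in> cgr C i; x' \<in> cgr C i; y \<in> cgr C j\<rbrakk>
    \<Longrightarrow> cmu C i j (cad C i x x') y = cad C (i+j) (cmu C i j x y) (cmu C i j x' y)"
  using cdga unfolding is_cdga_def by meson

lemma mult_add_right:
  "\<lbrakk>x \<in> cgr C i; y \<in> cgr C j; y' \<in> cgr C j\<rbrakk>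
    \<Longrightarrow> cmu C i j x (cad C j y y') = cad C (i+j) (cmu C i j x y) (cmu C i j x y')"
  using cdga unfolding is_cdga_def by meson

lemma mult_scale [simp]:
  assumes "x \<in> cgr C i" "y \<in> cgr C j"
  shows "cmu C i j (csc C i c x) y = csc C (i+j) c (cmu C i j x y)"
    and "cmu C i j x (csc C j c y) = csc C (i+j) c (cmu C i j x y)"
  using cdga assms unfolding is_cdga_def by meson+

lemma one_closed [simp]: "cun C \<in> cgr C 0"
  using cdga unfolding is_cdga_def by meson

lemma mult_one [simp]:
  assumes "x \<in> cgr C i"
  shows "cmu C 0 i (cun C) x = x" "cmu C i 0 x (cun C) = x"
  using cdga assms unfolding is_cdga_def by meson+

lemma mult_assoc:
  "\<lbrakk>x \<in> cgr C i; y \<in> cgr C j; z \<in> cgr C k; m = i + j\<rbrakk>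
    \<Longrightarrow> cmu C m k (cmu C i j x y) z = cmu C i (j+k) x (cmu C j k y z)"
  using cdga unfolding is_cdga_def by meson

lemma mult_comm:
  "x \<in> cgr C i \<Longrightarrow> y \<in> cgr C j \<Longrightarrow> cmu C i j x y = csc C (i+j) ((-1) ^ (i*j)) (cmu C j i y x)"
  using cdga unfolding is_cdga_def by meson

lemma d_closed [simp]: "x \<in> cgr C i \<Longrightarrow> m = Suc i \<Longrightarrow> cdf C i x \<in> cgr C m"
  using cdga unfolding is_cdga_def by meson

lemma d_add:
  "x \<in> cgr C i \<Longrightarrow> y \<in> cgr C i \<Longrightarrow> cdf C i (cad C i x y) = cad C (Suc i) (cdf C i x) (cdf C i y)"
  using cdga unfolding is_cdga_def by meson

lemma d_scale [simp]: "x \<in> cgr C i \<Longrightarrow> cdf C i (csc C i c x) = csc C (Suc i) c (cdf C i x)"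
  using cdga unfolding is_cdga_def by meson

lemma d_d [simp]: "x \<in> cgr C i \<Longrightarrow> cdf C (Suc i) (cdf C i x) = czr C (Suc (Suc i))"
  using cdga unfolding is_cdga_def by meson

lemma d_mult:
  "\<lbrakk>x \<in> cgr C i; y \<in> cgr C j; m = i + j\<rbrakk> \<Longrightarrow>
    cdf C m (cmu C i j x y) =
      cad C (Suc m) (cmu C (Suc i) j (cdf C i x) y)
                        (csc C (Suc m) ((-1) ^ i) (cmu C i (Suc j) x (cdf C j y)))"
  using cdga unfolding is_cdga_def by meson

lemma mult_zero_left [simp]: "y \<in> cgr C j \<Longrightarrow> m = i + j \<Longrightarrow> cmu C i j (czr C i) y = czr C m"
  using mult_scale(1)[of "czr C i" i y j 0] by simp

lemma mult_zero_right [simp]: "x \<in> cgr C i \<Longrightarrow> m = i + j \<Longrightarrow> cmu C i j x (czr C j) = czr C m"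
  using mult_scale(2)[of x i "czr C j" j 0] by simp

lemma d_zero [simp]: "m = Suc i \<Longrightarrow> cdf C i (czr C i) = czr C m"
  using d_scale[of "czr C i" i 0] by simp

text \<open>The Leibniz rule on \<open>1 * 1 = 1\<close> gives \<open>d 1 = d 1 + d 1\<close>;
  cancel.\<close>

lemma d_one [simp]: "cdf C 0 (cun C) = czr C (Suc 0)"
proof -
  let ?d = "cdf C 0 (cun C)"
  have "cad C (Suc 0) ?d ?d = cad C (Suc 0) ?d (czr C (Suc 0))"
    using d_mult[of "cun C" 0 "cun C" 0 0] by simp
  then show ?thesis by (subst (asm) add_cancel) auto
qed

lemma cocyclesI [intro]: "x \<in> cgr C i \<Longrightarrow> cdf C i x = czr C (Suc i) \<Longrightarrow> x \<in> cocycles C i"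
  by (simp add: cocycles_def)

lemma cocyclesD:
  assumes "x \<in> cocycles C i"
  shows "x \<in> cgr C i" "cdf C i x = czr C (Suc i)"
  using assms by (simp_all add: cocycles_def)

lemma zero_cocycle [simp]: "czr C i \<in> cocycles C i"
  by (simp add: cocycles_def)

lemma one_cocycle [simp]: "cun C \<in> cocycles C 0"
  by (simp add: cocycles_def)

lemma add_cocycle [simp]: "x \<in> cocycles C i \<Longrightarrow> y \<in> cocycles C i \<Longrightarrow> cad C i x y \<in> cocycles C i"
  by (simp add: cocycles_def d_add)

lemma scale_cocycle [simp]: "x \<in> cocycles C i \<Longrightarrow> csc C i c x \<in> cocycles C i"
  by (simp add: cocycles_def)

lemma mult_cocycle [simp]:
  "\<lbrakk>x \<in> cocycles C i; y \<in> cocycles C j; m = i + j\<rbrakk> \<Longrightarrow> cmu C i j x y \<in> cocycles C m"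
  by (simp add: cocycles_def d_mult)

lemma coboundaries_Suc: "coboundaries C (Suc i) = cdf C i ` cgr C i"
  by (simp add: coboundaries_def)

lemma coboundaries_0: "coboundaries C 0 = {czr C 0}"
  by (simp add: coboundaries_def)

lemma coboundary_cocycle: "x \<in> coboundaries C i \<Longrightarrow> x \<in> cocycles C i"
  by (cases i) (auto simp: coboundaries_Suc coboundaries_0)

lemma coboundary_closed: "x \<in> coboundaries C i \<Longrightarrow> x \<in> cgr C i"
  using coboundary_cocycle cocyclesD by blast

lemma zero_coboundary [simp]: "czr C i \<in> coboundaries C i"
proof (cases i)
  case (Suc k)
  have "cdf C k (czr C k) \<in> coboundaries C (Suc k)"
    unfolding coboundaries_Suc by (rule imageI) simp
  then show ?thesis using Suc by simp
qed (simp add: coboundaries_0)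

lemma add_coboundary [simp]:
  "x \<in> coboundaries C i \<Longrightarrow> y \<in> coboundaries C i \<Longrightarrow> cad C i x y \<in> coboundaries C i"
  by (cases i) (auto simp: coboundaries_Suc coboundaries_0 d_add[symmetric])

lemma scale_coboundary [simp]: "x \<in> coboundaries C i \<Longrightarrow> csc C i c x \<in> coboundaries C i"
  by (cases i) (auto simp: coboundaries_Suc coboundaries_0 d_scale[symmetric] simp del: d_scale)

text \<open>Since \<open>d y = 0\<close>, a product \<open>(d u) y\<close> equals
  \<open>d (u y)\<close>. In degree 0 the only coboundary is zero.\<close>

lemma mult_coboundary_left:
  assumes "x \<in> coboundaries C i" "y \<in> cocycles C j" "m = i + j"
  shows "cmu C i j x y \<in> coboundaries C m"
proof (cases i)
  case 0
  then show ?thesis using assms cocyclesD(1)[OF assms(2)] by (simp add: coboundaries_0)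
next
  case (Suc k)
  then obtain u where u: "u \<in> cgr C k" "x = cdf C k u" using assms by (auto simp: coboundaries_Suc)
  have "cmu C i j x y = cdf C (k + j) (cmu C k j u y)"
    using u cocyclesD[OF assms(2)] Suc by (simp add: d_mult)
  then show ?thesis using u cocyclesD[OF assms(2)] assms(3) Suc by (simp add: coboundaries_Suc)
qed

lemma mult_coboundary_right:
  assumes "x \<in> cocycles C i" "y \<in> coboundaries C j" "m = i + j"
  shows "cmu C i j x y \<in> coboundaries C m"
proof -
  have "cmu C j i y x \<in> coboundaries C m"
    using assms by (intro mult_coboundary_left) auto
  then show ?thesis
    using mult_comm[of x i y j] assms cocyclesD(1)[OF assms(1)] coboundary_closed[OF assms(2)]
    by simp
qed

lemma add_coboundary_iff:
  assumes "x \<in> cgr C i" "y \<in> coboundaries C i"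
  shows "cad C i x y \<in> coboundaries C i \<longleftrightarrow> x \<in> coboundaries C i"
proof
  assume "cad C i x y \<in> coboundaries C i"
  then have "cad C i (cad C i x y) (csc C i (-1) y) \<in> coboundaries C i" using assms by simp
  then show "x \<in> coboundaries C i" using assms coboundary_closed[OF assms(2)] by (simp add: add_assoc)
qed (use assms in simp)

subsection \<open>Cohomology\<close>

lemma coset_eq_iff:
  assumes "x \<in> cgr C i" "y \<in> cgr C i"
  shows "coset C i x = coset C i y \<longleftrightarrow> cad C i x (csc C i (-1) y) \<in> coboundaries C i"
proof
  assume eq: "coset C i x = coset C i y"
  have "cad C i x (czr C i) \<in> coset C i x" unfolding coset_def using zero_coboundary by blast
  then obtain b where b: "b \<in> coboundaries C i" "x = cad C i y b"
    using eq assms by (auto simp: coset_def)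
  moreover have "cad C i (cad C i y b) (csc C i (-1) y) = b"
    using assms coboundary_closed[OF b(1)] by (simp add: add_ac)
  ultimately show "cad C i x (csc C i (-1) y) \<in> coboundaries C i" using b by simp
next
  let ?b = "cad C i x (csc C i (-1) y)"
  assume b: "?b \<in> coboundaries C i"
  have x: "x = cad C i y ?b" using assms by (simp add: add_diff_cancel)
  have y: "y = cad C i x (csc C i (-1) ?b)" using assms
    by (metis add_eq_iff b coboundary_closed x)
  show "coset C i x = coset C i y"
  proof (intro equalityI subsetI)
    fix w assume "w \<in> coset C i x"
    then obtain e where e: "e \<in> coboundaries C i" "w = cad C i x e" by (auto simp: coset_def)
    then have "w = cad C i y (cad C i ?b e)"
      using x assms coboundary_closed[OF b] coboundary_closed[OF e(1)] by (metis add_assoc)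
    then show "w \<in> coset C i y" using e(1) b by (auto simp: coset_def)
  next
    fix w assume "w \<in> coset C i y"
    then obtain e where e: "e \<in> coboundaries C i" "w = cad C i y e" by (auto simp: coset_def)
    then have "w = cad C i x (cad C i (csc C i (-1) ?b) e)"
      using y assms coboundary_closed[OF b] coboundary_closed[OF e(1)]
      by (metis add_assoc scale_closed)
    moreover have "cad C i (csc C i (-1) ?b) e \<in> coboundaries C i" using e(1) b by simp
    ultimately show "w \<in> coset C i x" unfolding coset_def by blast
  qed
qed

lemma coset_add_coboundary:
  assumes "x \<in> cgr C i" "b \<in> coboundaries C i"
  shows "coset C i (cad C i x b) = coset C i x"
proof -
  have "cad C i (cad C i x b) (csc C i (-1) x) = b"
    using assms coboundary_closed[OF assms(2)] by (simp add: add_ac)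
  then show ?thesis using assms coboundary_closed[OF assms(2)] by (subst coset_eq_iff) auto
qed

lemma coset_eq_zero_iff:
  "x \<in> cgr C i \<Longrightarrow> coset C i x = coset C i (czr C i) \<longleftrightarrow> x \<in> coboundaries C i"
  by (simp add: coset_eq_iff)

text \<open>The operations of \<open>cohom\<close> act on representatives picked by Hilbert choice.
  All that is used about such a representative is that it differs from \<open>x\<close> by a
  coboundary.\<close>

lemma rep_coset:
  assumes "x \<in> cgr C i"
  obtains b where "b \<in> coboundaries C i" "rep (coset C i x) = cad C i x b"
proof -
  have "cad C i x (czr C i) \<in> coset C i x" unfolding coset_def using zero_coboundary by blast
  then have "rep (coset C i x) \<in> coset C i x" unfolding rep_def by (rule someI)
  then show ?thesis using that by (auto simp: coset_def)
qed

lemma cgr_cohom: "cgr (cohom C) i = coset C i ` cocycles C i"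
  by (simp add: cohom_def)

lemma czr_cohom: "czr (cohom C) i = coset C i (czr C i)"
  by (simp add: cohom_def)

lemma cun_cohom: "cun (cohom C) = coset C 0 (cun C)"
  by (simp add: cohom_def)

lemma cdf_cohom: "cdf (cohom C) i X = czr (cohom C) (Suc i)"
  by (simp add: cohom_def)

lemma cad_cohom:
  assumes "x \<in> cgr C i" "y \<in> cgr C i"
  shows "cad (cohom C) i (coset C i x) (coset C i y) = coset C i (cad C i x y)"
proof -
  obtain b where b: "b \<in> coboundaries C i" "rep (coset C i x) = cad C i x b"
    using rep_coset assms(1) .
  obtain e where e: "e \<in> coboundaries C i" "rep (coset C i y) = cad C i y e"
    using rep_coset assms(2) .
  have "cad C i (cad C i x b) (cad C i y e) = cad C i (cad C i x y) (cad C i b e)"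
    using assms coboundary_closed[OF b(1)] coboundary_closed[OF e(1)] by (simp add: add_ac)
  then show ?thesis using b e assms by (simp add: cohom_def coset_add_coboundary)
qed

lemma csc_cohom:
  assumes "x \<in> cgr C i"
  shows "csc (cohom C) i c (coset C i x) = coset C i (csc C i c x)"
proof -
  obtain b where b: "b \<in> coboundaries C i" "rep (coset C i x) = cad C i x b"
    using rep_coset assms(1) .
  have "csc C i c (cad C i x b) = cad C i (csc C i c x) (csc C i c b)"
    using assms coboundary_closed[OF b(1)] by (simp add: scale_add)
  then show ?thesis using b assms by (simp add: cohom_def coset_add_coboundary)
qed

text \<open>Expanding \<open>(x + b) (y + e)\<close> leaves \<open>x y\<close> plus
  \<open>x e + b (y + e)\<close>. Each term of this remainder is a coboundary times a cocycle, hence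
  a coboundary.\<close>

lemma cmu_cohom:
  assumes "x \<in> cocycles C i" "y \<in> cocycles C j"
  shows "cmu (cohom C) i j (coset C i x) (coset C j y) = coset C (i+j) (cmu C i j x y)"
proof -
  obtain b where b: "b \<in> coboundaries C i" "rep (coset C i x) = cad C i x b"
    using rep_coset cocyclesD(1)[OF assms(1)] .
  obtain e where e: "e \<in> coboundaries C j" "rep (coset C j y) = cad C j y e"
    using rep_coset cocyclesD(1)[OF assms(2)] .
  have *: "cmu C i j (cad C i x b) (cad C j y e) =
      cad C (i+j) (cmu C i j x y) (cad C (i+j) (cmu C i j x e) (cmu C i j b (cad C j y e)))"
    using cocyclesD(1)[OF assms(1)] cocyclesD(1)[OF assms(2)] coboundary_closed[OF b(1)]
      coboundary_closed[OF e(1)]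
    by (simp add: mult_add_left mult_add_right add_ac)
  have "cad C (i+j) (cmu C i j x e) (cmu C i j b (cad C j y e)) \<in> coboundaries C (i+j)"
    using assms b(1) e(1) coboundary_cocycle[OF e(1)]
    by (intro add_coboundary mult_coboundary_left mult_coboundary_right) auto
  then show ?thesis using b e cocyclesD(1)[OF assms(1)] cocyclesD(1)[OF assms(2)] *
    by (simp add: cohom_def coset_add_coboundary)
qed

lemma is_vs_cohom: "is_vs (cohom C) i"
proof -
  have neg: "\<exists>w\<in>cocycles C i. coset C i (cad C i x w) = coset C i (czr C i)"
    if "x \<in> cocycles C i" for x
    by (rule bexI[of _ "csc C i (-1) x"]) (use that in \<open>auto simp: cocyclesD(1)\<close>)
  note c = cocyclesD(1)
  show ?thesis
    unfolding is_vs_def Let_def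
    by (auto simp: cgr_cohom czr_cohom cad_cohom csc_cohom c add_ac scale_add scale_plus neg)
qed

lemma is_cdga_cohom: "is_cdga (cohom C)"
proof -
  note c = cocyclesD(1)
  note simps = cgr_cohom czr_cohom cad_cohom csc_cohom c cmu_cohom cun_cohom
  have comm: "cmu (cohom C) i j X Y = csc (cohom C) (i+j) ((-1) ^ (i*j)) (cmu (cohom C) j i Y X)"
    if XY: "X \<in> cgr (cohom C) i" "Y \<in> cgr (cohom C) j" for i j X Y
  proof -
    obtain x y where xy: "x \<in> cocycles C i" "y \<in> cocycles C j" "X = coset C i x" "Y = coset C j y"
      using XY by (auto simp: cgr_cohom)
    have "cmu C j i y x \<in> cgr C (i + j)" using xy by (simp add: c)
    then show ?thesis using xy mult_comm[of x i y j]
      by (simp add: cmu_cohom c csc_cohom add.commute[of j i])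
  qed
  have assoc: "cmu (cohom C) (i+j) k (cmu (cohom C) i j X Y) Z =
      cmu (cohom C) i (j+k) X (cmu (cohom C) j k Y Z)"
    if XYZ: "X \<in> cgr (cohom C) i" "Y \<in> cgr (cohom C) j" "Z \<in> cgr (cohom C) k" for i j k X Y Z
    using XYZ by (auto simp: simps mult_assoc add.assoc)
  show ?thesis
    unfolding is_cdga_def
    apply (intro conjI allI ballI)
    subgoal by (rule is_vs_cohom)
    subgoal by (auto simp: simps)
    subgoal by (auto simp: simps mult_add_left)
    subgoal by (auto simp: simps mult_add_right)
    subgoal by (auto simp: simps)
    subgoal by (auto simp: simps)
    subgoal by (auto simp: simps)
    subgoal by (auto simp: simps)
    subgoal by (auto simp: simps)
    subgoal by (rule assoc)
    subgoal by (rule comm)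
    subgoal by (auto simp: simps cdf_cohom)
    subgoal by (auto simp: simps cdf_cohom)
    subgoal by (auto simp: simps cdf_cohom)
    subgoal by (auto simp: simps cdf_cohom)
    subgoal by (auto simp: simps cdf_cohom)
    done
qed

end

section \<open>Homomorphisms and quasi-isomorphisms\<close>

locale gcdga_hom = C: gcdga C + D: gcdga D
  for C :: "('k::field, 'a) cdga" and D :: "('k, 'b) cdga" +
  fixes f :: "nat \<Rightarrow> 'a \<Rightarrow> 'b"
  assumes hom: "is_hom C D f"
begin

lemma closed [simp]: "x \<in> cgr C i \<Longrightarrow> f i x \<in> cgr D i"
  using hom unfolding is_hom_def by meson

lemma add: "x \<in> cgr C i \<Longrightarrow> y \<in> cgr C i \<Longrightarrow> f i (cad C i x y) = cad D i (f i x) (f i y)"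
  using hom unfolding is_hom_def by meson

lemma scale: "x \<in> cgr C i \<Longrightarrow> f i (csc C i c x) = csc D i c (f i x)"
  using hom unfolding is_hom_def by meson

lemma mult:
  "\<lbrakk>x \<in> cgr C i; y \<in> cgr C j; m = i + j\<rbrakk> \<Longrightarrow> f m (cmu C i j x y) = cmu D i j (f i x) (f j y)"
  using hom unfolding is_hom_def by meson

lemma diff: "x \<in> cgr C i \<Longrightarrow> m = Suc i \<Longrightarrow> f m (cdf C i x) = cdf D i (f i x)"
  using hom unfolding is_hom_def by meson

lemma zero [simp]: "f i (czr C i) = czr D i"
  using scale[of "czr C i" i 0] by simp

lemma cocycle: "x \<in> cocycles C i \<Longrightarrow> f i x \<in> cocycles D i"
  by (simp add: cocycles_def diff[symmetric])

lemma coboundary: "x \<in> coboundaries C i \<Longrightarrow> f i x \<in> coboundaries D i"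
  by (cases i) (auto simp: C.coboundaries_Suc C.coboundaries_0 D.coboundaries_Suc diff)

text \<open>The map in \<open>quasi_iso\<close> goes through a chosen representative; this
  identifies it with the usual induced map on cohomology.\<close>

lemma induced_coset:
  assumes "x \<in> cgr C i"
  shows "coset D i (f i (rep (coset C i x))) = coset D i (f i x)"
proof -
  obtain b where b: "b \<in> coboundaries C i" "rep (coset C i x) = cad C i x b"
    using C.rep_coset assms .
  then show ?thesis
    using assms C.coboundary_closed[OF b(1)] coboundary[OF b(1)]
    by (simp add: add D.coset_add_coboundary)
qed

end

locale gcdga_quasi_iso = gcdga_hom +
  assumes quasi_iso: "quasi_iso C D f"
begin

text \<open>This lemma and \<open>cocycle_lift\<close> restate injectivity and surjectivity on
  cohomology in terms of cochains, the form in which quasi-isomorphisms are used below.\<close>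

lemma coboundary_reflect:
  assumes "x \<in> cocycles C i" "f i x \<in> coboundaries D i"
  shows "x \<in> coboundaries C i"
proof -
  have x: "x \<in> cgr C i" using assms C.cocyclesD by blast
  have "inj_on (\<lambda>X. coset D i (f i (rep X))) (cgr (cohom C) i)"
    using quasi_iso by (simp add: quasi_iso_def bij_betw_def)
  moreover have "coset D i (f i x) = coset D i (f i (czr C i))"
    using assms(2) x by (simp add: D.coset_eq_zero_iff)
  ultimately have "coset C i x = coset C i (czr C i)"
    using assms(1) x
    by (intro inj_onD[of "\<lambda>X. coset D i (f i (rep X))" "cgr (cohom C) i"])
      (simp_all add: C.cgr_cohom induced_coset)
  then show ?thesis using x by (simp add: C.coset_eq_zero_iff)
qed

lemma cocycle_lift:
  assumes "y \<in> cocycles D i"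
  obtains x e where "x \<in> cocycles C i" "e \<in> coboundaries D i" "y = cad D i (f i x) e"
proof -
  have y: "y \<in> cgr D i" using assms D.cocyclesD by blast
  have "(\<lambda>X. coset D i (f i (rep X))) ` cgr (cohom C) i = cgr (cohom D) i"
    using quasi_iso by (simp add: quasi_iso_def bij_betw_def)
  moreover have "coset D i y \<in> cgr (cohom D) i"
    using assms by (simp add: D.cgr_cohom)
  ultimately obtain x where x: "x \<in> cocycles C i" "coset D i y = coset D i (f i (rep (coset C i x)))"
    by (auto simp: C.cgr_cohom)
  then have "coset D i y = coset D i (f i x)" by (simp add: induced_coset C.cocyclesD(1))
  then have "cad D i y (csc D i (-1) (f i x)) \<in> coboundaries D i"
    using y x(1) by (simp add: D.coset_eq_iff C.cocyclesD(1))
  moreover have "y = cad D i (f i x) (cad D i y (csc D i (-1) (f i x)))"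
    using y C.cocyclesD(1)[OF x(1)] by (simp add: D.add_diff_cancel)
  ultimately show ?thesis using that x(1) by blast
qed

end

subsection \<open>Triple Massey products\<close>

text \<open>
  The first and last degrees are \<open>i + 1\<close> and \<open>l + 1\<close>, which keeps the degrees of the primitives \<open>p\<close>
  and \<open>q\<close> free of truncated subtraction.
\<close>

definition massey_vanishes :: "('k::field, 'a) cdga \<Rightarrow> nat \<Rightarrow> nat \<Rightarrow> nat \<Rightarrow> 'a \<Rightarrow> 'a \<Rightarrow> 'a \<Rightarrow> bool" where
  "massey_vanishes C i j l a b z \<longleftrightarrow>
    (\<exists>p\<in>cgr C (i+j). \<exists>q\<in>cgr C (j+l).
       cdf C (i+j) p = cmu C (Suc i) j a b \<and> cdf C (j+l) q = cmu C j (Suc l) b z \<and>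
       cad C (Suc (i+j+l)) (cmu C (i+j) (Suc l) p z)
         (csc C (Suc (i+j+l)) ((-1) ^ i) (cmu C (Suc i) (j+l) a q)) \<in> coboundaries C (Suc (i+j+l)))"

text \<open>The Massey product is a set, and zero is only required to be one of its elements: the
  primitives \<open>p\<close> and \<open>q\<close> are supplied by the conclusion. The sign
  \<open>(-1) ^ i\<close> makes \<open>p z + (-1) ^ i a q\<close> closed, because \<open>a\<close>
  has degree \<open>i + 1\<close>.\<close>

definition massey_trivial :: "('k::field, 'a) cdga \<Rightarrow> bool" where
  "massey_trivial C \<longleftrightarrow>
    (\<forall>i j l. \<forall>a\<in>cocycles C (Suc i). \<forall>b\<in>cocycles C j. \<forall>z\<in>cocycles C (Suc l).
       cmu C (Suc i) j a b \<in> coboundaries C (Suc (i+j)) \<longrightarrow>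
       cmu C j (Suc l) b z \<in> coboundaries C (Suc (j+l)) \<longrightarrow> massey_vanishes C i j l a b z)"

section \<open>Independence of Massey vanishing from the representatives\<close>

context gcdga
begin

text \<open>For \<open>e = d u\<close> replace \<open>p\<close> by \<open>p + u b\<close> and keep
  \<open>q\<close>. The Massey cocycle then changes by \<open>(-1)^i d (u q)\<close>, which is
  exact.\<close>

lemma massey_vanishes_left:
  assumes v: "massey_vanishes C i j l a b z"
    and a: "a \<in> cocycles C (Suc i)" and b: "b \<in> cocycles C j" and z: "z \<in> cocycles C (Suc l)"
    and e: "e \<in> coboundaries C (Suc i)"
  shows "massey_vanishes C i j l (cad C (Suc i) a e) b z"
proof -
  obtain p q where p: "p \<in> cgr C (i+j)" and q: "q \<in> cgr C (j+l)"
    and dp: "cdf C (i+j) p = cmu C (Suc i) j a b" and dq: "cdf C (j+l) q = cmu C j (Suc l) b z"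
    and pq: "cad C (Suc (i+j+l)) (cmu C (i+j) (Suc l) p z)
         (csc C (Suc (i+j+l)) ((-1) ^ i) (cmu C (Suc i) (j+l) a q)) \<in> coboundaries C (Suc (i+j+l))"
    using v unfolding massey_vanishes_def by blast
  obtain u where u: "u \<in> cgr C i" and e': "e = cdf C i u" using e by (auto simp: coboundaries_Suc)
  note [simp] = cocyclesD[OF a] cocyclesD[OF b] cocyclesD[OF z] p q u
  let ?m = "Suc (i+j+l)"
  let ?p = "cad C (i+j) p (cmu C i j u b)"
  let ?w = "csc C ?m ((-1)^i) (cdf C (i+j+l) (cmu C i (j+l) u q))"
  have "cdf C (i+j) ?p = cmu C (Suc i) j (cad C (Suc i) a e) b"
    by (simp add: d_add d_mult dp e' mult_add_left)
  moreover have "cad C ?m (cmu C (i+j) (Suc l) ?p z)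
         (csc C ?m ((-1) ^ i) (cmu C (Suc i) (j+l) (cad C (Suc i) a e) q)) =
    cad C ?m (cad C ?m (cmu C (i+j) (Suc l) p z)
         (csc C ?m ((-1) ^ i) (cmu C (Suc i) (j+l) a q))) ?w"
    by (simp add: d_mult dq e' mult_add_left mult_assoc scale_add add_ac add.assoc
        flip: power_add mult_2)
  moreover have "?w \<in> coboundaries C ?m"
    by (intro scale_coboundary) (auto simp: coboundaries_Suc add.assoc)
  ultimately show ?thesis
    unfolding massey_vanishes_def using dq pq
    by (intro bexI[of _ ?p] bexI[of _ q]) (auto intro: add_coboundary)
qed

text \<open>For \<open>e = d u\<close> replace \<open>p\<close> by \<open>p - (-1)^i a u\<close> and
  \<open>q\<close> by \<open>q + u z\<close>. The two corrections contribute \<open>a u z\<close>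
  with opposite signs, so the Massey cocycle itself does not change.\<close>

lemma massey_vanishes_middle:
  assumes v: "massey_vanishes C i j l a b z"
    and a: "a \<in> cocycles C (Suc i)" and b: "b \<in> cocycles C j" and z: "z \<in> cocycles C (Suc l)"
    and e: "e \<in> coboundaries C j"
  shows "massey_vanishes C i j l a (cad C j b e) z"
proof (cases j)
  case 0
  then show ?thesis using v e cocyclesD(1)[OF b] by (simp add: coboundaries_0)
next
  case (Suc k)
  let ?m = "Suc (Suc (i+k+l))"
  obtain p q where p: "p \<in> cgr C (Suc (i+k))" and q: "q \<in> cgr C (Suc (k+l))"
    and dp: "cdf C (Suc (i+k)) p = cmu C (Suc i) (Suc k) a b"
    and dq: "cdf C (Suc (k+l)) q = cmu C (Suc k) (Suc l) b z"
    and pq: "cad C ?m (cmu C (Suc (i+k)) (Suc l) p z)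
         (csc C ?m ((-1) ^ i) (cmu C (Suc i) (Suc (k+l)) a q)) \<in> coboundaries C ?m"
    using v unfolding massey_vanishes_def Suc by auto
  obtain u where u: "u \<in> cgr C k" and e': "e = cdf C k u"
    using e Suc by (auto simp: coboundaries_Suc)
  note [simp] = cocyclesD[OF a] cocyclesD[OF b[unfolded Suc]] cocyclesD[OF z] p q u
  let ?p = "cad C (Suc (i+k)) p (csc C (Suc (i+k)) (- ((-1)^i)) (cmu C (Suc i) k a u))"
  let ?q = "cad C (Suc (k+l)) q (cmu C k (Suc l) u z)"
  have "cdf C (Suc (i+k)) ?p = cmu C (Suc i) (Suc k) a (cad C (Suc k) b e)"
    by (simp add: d_add d_mult dp e' mult_add_right flip: power_add mult_2)
  moreover have "cdf C (Suc (k+l)) ?q = cmu C (Suc k) (Suc l) (cad C (Suc k) b e) z"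
    by (simp add: d_add d_mult dq e' mult_add_left)
  moreover have "cad C ?m (cmu C (Suc (i+k)) (Suc l) ?p z)
         (csc C ?m ((-1) ^ i) (cmu C (Suc i) (Suc (k+l)) a ?q)) =
    cad C ?m (cmu C (Suc (i+k)) (Suc l) p z) (csc C ?m ((-1) ^ i) (cmu C (Suc i) (Suc (k+l)) a q))"
  proof -
    let ?w = "cmu C (Suc i) (Suc (k+l)) a (cmu C k (Suc l) u z)"
    let ?pz = "cmu C (Suc (i+k)) (Suc l) p z" and ?aq = "cmu C (Suc i) (Suc (k+l)) a q"
    have mem: "?w \<in> cgr C ?m" "?pz \<in> cgr C ?m" "?aq \<in> cgr C ?m" by simp_all
    have 1: "cmu C (Suc (i+k)) (Suc l) ?p z = cad C ?m ?pz (csc C ?m (- ((-1)^i)) ?w)"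
      by (simp add: mult_add_left mult_assoc)
    have 2: "cmu C (Suc i) (Suc (k+l)) a ?q = cad C ?m ?aq ?w"
      by (simp add: mult_add_right add.assoc)
    have 3: "cad C ?m (csc C ?m (- ((-1)^i)) ?w) (csc C ?m ((-1)^i) ?w) = czr C ?m"
      using scale_plus[OF mem(1), of "- ((-1)^i)" "(-1)^i"] mem by simp
    show ?thesis unfolding 1 2 using mem 3
      by (simp add: scale_add add_assoc add_lcomm[of "csc C ?m (- ((-1)^i)) ?w"])
  qed
  ultimately show ?thesis
    unfolding massey_vanishes_def Suc using pq
    by (intro bexI[of _ ?p] bexI[of _ ?q]) auto
qed

text \<open>For \<open>e = d u\<close> keep \<open>p\<close> and replace \<open>q\<close> by
  \<open>q + (-1)^j b u\<close>. The Massey cocycle changes by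
  \<open>(-1)^(i+j) d (p u)\<close>.\<close>

lemma massey_vanishes_right:
  assumes v: "massey_vanishes C i j l a b z"
    and a: "a \<in> cocycles C (Suc i)" and b: "b \<in> cocycles C j" and z: "z \<in> cocycles C (Suc l)"
    and e: "e \<in> coboundaries C (Suc l)"
  shows "massey_vanishes C i j l a b (cad C (Suc l) z e)"
proof -
  obtain p q where p: "p \<in> cgr C (i+j)" and q: "q \<in> cgr C (j+l)"
    and dp: "cdf C (i+j) p = cmu C (Suc i) j a b" and dq: "cdf C (j+l) q = cmu C j (Suc l) b z"
    and pq: "cad C (Suc (i+j+l)) (cmu C (i+j) (Suc l) p z)
         (csc C (Suc (i+j+l)) ((-1) ^ i) (cmu C (Suc i) (j+l) a q)) \<in> coboundaries C (Suc (i+j+l))"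
    using v unfolding massey_vanishes_def by blast
  obtain u where u: "u \<in> cgr C l" and e': "e = cdf C l u" using e by (auto simp: coboundaries_Suc)
  note [simp] = cocyclesD[OF a] cocyclesD[OF b] cocyclesD[OF z] p q u
  let ?m = "Suc (i+j+l)"
  let ?q = "cad C (j+l) q (csc C (j+l) ((-1)^j) (cmu C j l b u))"
  let ?w = "csc C ?m ((-1)^(i+j)) (cdf C (i+j+l) (cmu C (i+j) l p u))"
  have "cdf C (j+l) ?q = cmu C j (Suc l) b (cad C (Suc l) z e)"
    by (simp add: d_add d_mult dq e' mult_add_right flip: power_add mult_2)
  moreover have "cad C ?m (cmu C (i+j) (Suc l) p (cad C (Suc l) z e))
         (csc C ?m ((-1) ^ i) (cmu C (Suc i) (j+l) a ?q)) =
    cad C ?m (cad C ?m (cmu C (i+j) (Suc l) p z)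
         (csc C ?m ((-1) ^ i) (cmu C (Suc i) (j+l) a q))) ?w"
    by (simp add: d_mult dp e' mult_add_right mult_assoc scale_add add_ac add.assoc
        flip: power_add mult_2)
  moreover have "?w \<in> coboundaries C ?m"
    by (intro scale_coboundary) (auto simp: coboundaries_Suc add.assoc)
  ultimately show ?thesis
    unfolding massey_vanishes_def using dp pq
    by (intro bexI[of _ p] bexI[of _ ?q]) (auto intro: add_coboundary)
qed

text \<open>With zero differential the only coboundary is zero, so both products vanish on the nose
  and \<open>p = q = 0\<close> are primitives.\<close>

lemma massey_trivial_cohom: "massey_trivial (cohom C)"
proof -
  interpret H: gcdga "cohom C" by standard (rule is_cdga_cohom)
  have B: "coboundaries (cohom C) i = {czr (cohom C) i}" for i
  proof (cases i)
    case (Suc k)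
    moreover have "cgr (cohom C) k \<noteq> {}" using H.zero_closed[of k] by blast
    ultimately show ?thesis by (simp add: H.coboundaries_Suc cdf_cohom image_constant_conv)
  qed (simp add: H.coboundaries_0)
  show ?thesis
    unfolding massey_trivial_def massey_vanishes_def B
  proof (intro allI ballI impI)
    fix i j l a b z
    assume a: "a \<in> cocycles (cohom C) (Suc i)" and z: "z \<in> cocycles (cohom C) (Suc l)"
      and "cmu (cohom C) (Suc i) j a b \<in> {czr (cohom C) (Suc (i + j))}"
      and "cmu (cohom C) j (Suc l) b z \<in> {czr (cohom C) (Suc (j + l))}"
    moreover have "cmu (cohom C) (i + j) (Suc l) (czr (cohom C) (i + j)) z = czr (cohom C) (Suc (i + j + l))"
      "cmu (cohom C) (Suc i) (j + l) a (czr (cohom C) (j + l)) = czr (cohom C) (Suc (i + j + l))"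
      using H.cocyclesD(1)[OF a] H.cocyclesD(1)[OF z] by (simp_all add: add.assoc)
    ultimately show "\<exists>p\<in>cgr (cohom C) (i + j). \<exists>q\<in>cgr (cohom C) (j + l).
          cdf (cohom C) (i + j) p = cmu (cohom C) (Suc i) j a b \<and>
          cdf (cohom C) (j + l) q = cmu (cohom C) j (Suc l) b z \<and>
          cad (cohom C) (Suc (i + j + l)) (cmu (cohom C) (i + j) (Suc l) p z)
           (csc (cohom C) (Suc (i + j + l)) ((-1) ^ i) (cmu (cohom C) (Suc i) (j + l) a q))
          \<in> {czr (cohom C) (Suc (i + j + l))}"
      by (intro bexI[of _ "czr (cohom C) (i + j)"] bexI[of _ "czr (cohom C) (j + l)"])
        (simp_all add: cdf_cohom)
  qed
qed

end

section \<open>Invariance of Massey triviality under quasi-isomorphism\<close>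

context gcdga_hom
begin

lemma massey_vanishes_image:
  assumes v: "massey_vanishes C i j l a b z"
    and a: "a \<in> cocycles C (Suc i)" and b: "b \<in> cocycles C j" and z: "z \<in> cocycles C (Suc l)"
  shows "massey_vanishes D i j l (f (Suc i) a) (f j b) (f (Suc l) z)"
proof -
  obtain p q where p: "p \<in> cgr C (i+j)" and q: "q \<in> cgr C (j+l)"
    and dp: "cdf C (i+j) p = cmu C (Suc i) j a b" and dq: "cdf C (j+l) q = cmu C j (Suc l) b z"
    and pq: "cad C (Suc (i+j+l)) (cmu C (i+j) (Suc l) p z)
         (csc C (Suc (i+j+l)) ((-1) ^ i) (cmu C (Suc i) (j+l) a q)) \<in> coboundaries C (Suc (i+j+l))"
    using v unfolding massey_vanishes_def by blast
  note [simp] = C.cocyclesD(1)[OF a] C.cocyclesD(1)[OF b] C.cocyclesD(1)[OF z] p q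
  have "cdf D (i+j) (f (i+j) p) = cmu D (Suc i) j (f (Suc i) a) (f j b)"
    using arg_cong[OF dp, of "f (Suc (i+j))"] by (simp add: diff mult)
  moreover have "cdf D (j+l) (f (j+l) q) = cmu D j (Suc l) (f j b) (f (Suc l) z)"
    using arg_cong[OF dq, of "f (Suc (j+l))"] by (simp add: diff mult)
  moreover have "cad D (Suc (i+j+l)) (cmu D (i+j) (Suc l) (f (i+j) p) (f (Suc l) z))
         (csc D (Suc (i+j+l)) ((-1) ^ i) (cmu D (Suc i) (j+l) (f (Suc i) a) (f (j+l) q)))
       \<in> coboundaries D (Suc (i+j+l))"
    using coboundary[OF pq] by (simp add: add scale mult)
  ultimately show ?thesis unfolding massey_vanishes_def by (meson closed p q)
qed

end

context gcdga_quasi_iso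
begin

text \<open>Lift the three classes to \<open>C\<close>, use triviality there, push the primitives
  forward, and then correct the representatives one at a time with the three preceding invariance
  lemmas.\<close>

lemma massey_trivial_forward:
  assumes "massey_trivial C"
  shows "massey_trivial D"
  unfolding massey_trivial_def
proof (intro allI ballI impI)
  fix i j l a b z
  assume a: "a \<in> cocycles D (Suc i)" and b: "b \<in> cocycles D j" and z: "z \<in> cocycles D (Suc l)"
    and ab: "cmu D (Suc i) j a b \<in> coboundaries D (Suc (i+j))"
    and bz: "cmu D j (Suc l) b z \<in> coboundaries D (Suc (j+l))"
  obtain a' ea where a': "a' \<in> cocycles C (Suc i)" "ea \<in> coboundaries D (Suc i)"
    "a = cad D (Suc i) (f (Suc i) a') ea" using cocycle_lift[OF a] .
  obtain b' eb where b': "b' \<in> cocycles C j" "eb \<in> coboundaries D j"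
    "b = cad D j (f j b') eb" using cocycle_lift[OF b] .
  obtain z' ez where z': "z' \<in> cocycles C (Suc l)" "ez \<in> coboundaries D (Suc l)"
    "z = cad D (Suc l) (f (Suc l) z') ez" using cocycle_lift[OF z] .
  note c = C.cocyclesD(1)[OF a'(1)] C.cocyclesD(1)[OF b'(1)] C.cocyclesD(1)[OF z'(1)]
  note fc = cocycle[OF a'(1)] cocycle[OF b'(1)] cocycle[OF z'(1)]
  \<comment> \<open>The image of the product of two lifts agrees with the given exact product up to
    a coboundary, so injectivity on cohomology makes the product of the lifts exact in
    \<open>C\<close>.\<close>
  have prod: "cmu C r s x y \<in> coboundaries C m"
    if "x \<in> cocycles C r" "y \<in> cocycles C s" "m = r + s"
      "ex \<in> coboundaries D r" "ey \<in> coboundaries D s"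
      "cmu D r s (cad D r (f r x) ex) (cad D s (f s y) ey) \<in> coboundaries D m"
    for r s m x y ex ey
  proof -
    note [simp] = C.cocyclesD(1)[OF that(1)] C.cocyclesD(1)[OF that(2)]
      D.coboundary_closed[OF that(4)] D.coboundary_closed[OF that(5)]
    have "cmu D r s (cad D r (f r x) ex) (cad D s (f s y) ey) =
        cad D m (cmu D r s (f r x) (f s y))
          (cad D m (cmu D r s (f r x) ey) (cmu D r s ex (cad D s (f s y) ey)))"
      using that(3) by (simp add: D.mult_add_left D.mult_add_right D.add_ac)
    moreover have "cad D m (cmu D r s (f r x) ey) (cmu D r s ex (cad D s (f s y) ey)) \<in> coboundaries D m"
      using that cocycle D.coboundary_cocycle
      by (intro D.add_coboundary D.mult_coboundary_left D.mult_coboundary_right) auto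
    ultimately have "cmu D r s (f r x) (f s y) \<in> coboundaries D m"
      using that(3,6) by (simp add: D.add_coboundary_iff)
    then show ?thesis using that(1-3)
      by (intro coboundary_reflect) (auto simp: mult)
  qed
  have "massey_vanishes C i j l a' b' z'"
    using assms a' b' z' ab bz prod[OF a'(1) b'(1) _ a'(2) b'(2)] prod[OF b'(1) z'(1) _ b'(2) z'(2)]
    unfolding massey_trivial_def by auto
  then have "massey_vanishes D i j l (f (Suc i) a') (f j b') (f (Suc l) z')"
    using a' b' z' by (intro massey_vanishes_image)
  then have "massey_vanishes D i j l a (f j b') (f (Suc l) z')"
    unfolding a'(3) using fc a'(2) by (intro D.massey_vanishes_left)
  then have "massey_vanishes D i j l a b (f (Suc l) z')"
    unfolding b'(3) using fc a b'(2) by (intro D.massey_vanishes_middle)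
  then show "massey_vanishes D i j l a b z"
    unfolding z'(3) using fc a b z'(2) by (intro D.massey_vanishes_right)
qed

text \<open>The primitives found in \<open>D\<close> need not be images from \<open>C\<close>.
  Changing them by coboundaries makes them so, and the Massey cocycle in \<open>C\<close> is then
  exact because its image is.\<close>

lemma massey_trivial_backward:
  assumes "massey_trivial D"
  shows "massey_trivial C"
  unfolding massey_trivial_def
proof (intro allI ballI impI)
  fix i j l a b z
  assume a: "a \<in> cocycles C (Suc i)" and b: "b \<in> cocycles C j" and z: "z \<in> cocycles C (Suc l)"
    and ab: "cmu C (Suc i) j a b \<in> coboundaries C (Suc (i+j))"
    and bz: "cmu C j (Suc l) b z \<in> coboundaries C (Suc (j+l))"
  note [simp] = C.cocyclesD[OF a] C.cocyclesD[OF b] C.cocyclesD[OF z]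
  let ?a = "f (Suc i) a" and ?b = "f j b" and ?z = "f (Suc l) z" and ?m = "Suc (i+j+l)"
  note fc [simp] = cocycle[OF a] cocycle[OF b] cocycle[OF z]
  have "massey_vanishes D i j l ?a ?b ?z"
    using assms coboundary[OF ab] coboundary[OF bz] unfolding massey_trivial_def
    by (simp add: mult)
  then obtain p' q' where p': "p' \<in> cgr D (i+j)" and q': "q' \<in> cgr D (j+l)"
    and dp': "cdf D (i+j) p' = cmu D (Suc i) j ?a ?b" and dq': "cdf D (j+l) q' = cmu D j (Suc l) ?b ?z"
    and pq': "cad D ?m (cmu D (i+j) (Suc l) p' ?z)
         (csc D ?m ((-1) ^ i) (cmu D (Suc i) (j+l) ?a q')) \<in> coboundaries D ?m"
    unfolding massey_vanishes_def by blast
  \<comment> \<open>Take any primitive \<open>x\<close> of \<open>w\<close>. The difference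
    \<open>f x - x'\<close> is closed, hence of the form \<open>f v + e\<close> with
    \<open>v\<close> a cocycle and \<open>e\<close> exact; then \<open>x - v\<close> is still a
    primitive of \<open>w\<close> and maps to \<open>x' + e\<close>.\<close>
  have adjust: "\<exists>x\<in>cgr C m. cdf C m x = w \<and> (\<exists>e\<in>coboundaries D m. f m x = cad D m x' e)"
    if w: "w \<in> coboundaries C (Suc m)" and x': "x' \<in> cgr D m" "cdf D m x' = f (Suc m) w" for m w x'
  proof -
    obtain x where x: "x \<in> cgr C m" "w = cdf C m x" using w by (auto simp: C.coboundaries_Suc)
    have "cad D m (f m x) (csc D m (-1) x') \<in> cocycles D m"
      using x x' by (auto simp: cocycles_def D.d_add diff)
    then obtain v e where v: "v \<in> cocycles C m" "e \<in> coboundaries D m"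
      "cad D m (f m x) (csc D m (-1) x') = cad D m (f m v) e" by (rule cocycle_lift)
    note [simp] = C.cocyclesD[OF v(1)] D.coboundary_closed[OF v(2)]
    let ?x = "cad C m x (csc C m (-1) v)"
    have "f m x = cad D m (cad D m (f m v) e) x'"
      using v(3) x x' D.add_eq_iff[of "f m x" m "csc D m (-1) x'"] by simp
    then have "f m ?x = cad D m x' e"
      using x x' by (simp add: add scale D.add_ac)
    then show ?thesis using x v(2)
      by (intro bexI[of _ ?x]) (auto simp: C.d_add)
  qed
  obtain p e where p: "p \<in> cgr C (i+j)" "cdf C (i+j) p = cmu C (Suc i) j a b"
    and e: "e \<in> coboundaries D (i+j)" "f (i+j) p = cad D (i+j) p' e"
    using adjust[OF ab p'] dp' by (auto simp: mult)
  obtain q h where q: "q \<in> cgr C (j+l)" "cdf C (j+l) q = cmu C j (Suc l) b z"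
    and h: "h \<in> coboundaries D (j+l)" "f (j+l) q = cad D (j+l) q' h"
    using adjust[OF bz q'] dq' by (auto simp: mult)
  note [simp] = p(1) q(1) D.coboundary_closed[OF e(1)] D.coboundary_closed[OF h(1)] p' q'
  let ?w = "cad C ?m (cmu C (i+j) (Suc l) p z) (csc C ?m ((-1) ^ i) (cmu C (Suc i) (j+l) a q))"
  have "f ?m ?w = cad D ?m (cmu D (i+j) (Suc l) (f (i+j) p) ?z)
         (csc D ?m ((-1) ^ i) (cmu D (Suc i) (j+l) ?a (f (j+l) q)))"
    by (simp add: add scale mult)
  \<comment> \<open>The corrections \<open>e\<close> and \<open>h\<close> only enter through
    products with the cocycles \<open>?z\<close> and \<open>?a\<close>, which are exact.\<close>
  also have "\<dots> = cad D ?m (cad D ?m (cmu D (i+j) (Suc l) p' ?z)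
         (csc D ?m ((-1) ^ i) (cmu D (Suc i) (j+l) ?a q')))
     (cad D ?m (cmu D (i+j) (Suc l) e ?z) (csc D ?m ((-1) ^ i) (cmu D (Suc i) (j+l) ?a h)))"
    unfolding e h by (simp add: D.mult_add_left D.mult_add_right D.scale_add D.add_ac add.assoc)
  also have "\<dots> \<in> coboundaries D ?m"
    using e(1) h(1)
    by (intro D.add_coboundary[OF pq'] D.add_coboundary D.scale_coboundary D.mult_coboundary_left D.mult_coboundary_right) auto
  finally have "f ?m ?w \<in> coboundaries D ?m" .
  moreover have "?w \<in> cocycles C ?m"
    by (simp add: C.d_add C.d_mult p q C.mult_assoc cocycles_def add.assoc flip: power_add mult_2)
  ultimately have "?w \<in> coboundaries C ?m" by (intro coboundary_reflect)
  then show "massey_vanishes C i j l a b z"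
    unfolding massey_vanishes_def using p q by blast
qed

end

section \<open>Formality implies Massey triviality\<close>

lemma massey_trivial_qrel:
  assumes "is_cdga C" "is_cdga D" "qrel C D" "massey_trivial D"
  shows "massey_trivial C"
  using assms(3) unfolding qrel_def
proof (elim disjE exE)
  fix f assume "quasi_iso C D f"
  then interpret gcdga_quasi_iso C D f
    using assms by unfold_locales (auto simp: quasi_iso_def)
  show ?thesis using assms massey_trivial_backward by blast
next
  fix f assume "quasi_iso D C f"
  then interpret gcdga_quasi_iso D C f
    using assms by unfold_locales (auto simp: quasi_iso_def)
  show ?thesis using assms massey_trivial_forward by blast
qed

text \<open>Triviality holds at the cohomology end of the zigzag and is carried back to
  \<open>C\<close> link by link; each link may point either way.\<close>

lemma formal_imp_massey_trivial:
  fixes C :: "('a::field, 'b) cdga" and T :: "'c itself"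
  assumes "is_cdga C" "formal T C"
  shows "massey_trivial C"
proof -
  interpret gcdga C by standard fact
  obtain Z :: "nat \<Rightarrow> ('a, 'c) cdga" and N where "(\<forall>k\<le>N. is_cdga (Z k)) \<and> qrel C (Z 0) \<and>
      (\<forall>k<N. qrel (Z k) (Z (Suc k))) \<and> qrel (Z N) (cohom C)"
    using assms(2) unfolding formal_def by (elim exE)
  then have Z: "\<And>k. k \<le> N \<Longrightarrow> is_cdga (Z k)" "qrel C (Z 0)"
    "\<And>k. k < N \<Longrightarrow> qrel (Z k) (Z (Suc k))" "qrel (Z N) (cohom C)"
    by simp_all
  have "massey_trivial (Z N)"
    using Z is_cdga_cohom massey_trivial_cohom massey_trivial_qrel by blast
  \<comment> \<open>Downward induction from \<open>Z N\<close> to \<open>Z 0\<close>, with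
    \<open>k\<close> counting the links already crossed.\<close>
  then have "massey_trivial (Z (N - k))" if "k \<le> N" for k
    using that
  proof (induction k)
    case (Suc k)
    then have "N - k = Suc (N - Suc k)" by simp
    with Suc show ?case
      using massey_trivial_qrel[of "Z (N - Suc k)" "Z (N - k)"] Z(1,3)[of "N - Suc k"] Z(1)[of "N - k"]
      by auto
  qed simp
  from this[of N] show ?thesis using Z assms massey_trivial_qrel by auto
qed

subsection \<open>The extension by theta\<close>

locale gcdga_theta = gcdga C for C :: "('k::field, 'a) cdga" +
  fixes n :: nat and \<omega> :: 'a
  assumes n_pos: "1 \<le> n" and omega: "\<omega> \<in> cocycles C (2 * n)"
begin

text \<open>The degree of \<theta>; by \<open>n_pos\<close> the subtraction is not
  truncated.\<close>

definition t :: nat where "t = 2 * n - 1"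

abbreviation T :: "('k, 'a \<times> 'a) cdga" where "T \<equiv> theta_ext C n \<omega>"

lemma two_n: "2 * n = Suc t"
  using n_pos by (simp add: t_def)

lemma odd_t: "odd t"
  using two_n by (metis even_Suc even_mult_iff even_numeral)

lemma neg_one_power_t [simp]: "(-1 :: 'k) ^ t = -1"
  using odd_t by simp

lemma omega_closed [simp]: "\<omega> \<in> cgr C (Suc t)"
  using cocyclesD[OF omega] by (simp add: two_n)

lemma d_omega [simp]: "cdf C (Suc t) \<omega> = czr C (Suc (Suc t))"
  using cocyclesD[OF omega] by (simp add: two_n)

lemma cgr_T: "(x, y) \<in> cgr T i \<longleftrightarrow> x \<in> cgr C i \<and> (if t \<le> i then y \<in> cgr C (i - t) else y = czr C 0)"
  by (simp add: theta_ext_def Let_def t_def)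

lemma czr_T: "czr T i = (czr C i, if t \<le> i then czr C (i - t) else czr C 0)"
  by (simp add: theta_ext_def Let_def t_def)

lemma cad_T:
  "cad T i (x, y) (x', y') = (cad C i x x', if t \<le> i then cad C (i - t) y y' else czr C 0)"
  by (simp add: theta_ext_def Let_def t_def)

lemma csc_T: "csc T i c (x, y) = (csc C i c x, if t \<le> i then csc C (i - t) c y else czr C 0)"
  by (simp add: theta_ext_def Let_def t_def)

lemma cun_T: "cun T = (cun C, czr C 0)"
  by (simp add: theta_ext_def Let_def t_def)

lemma cmu_T:
  "cmu T i j (x, y) (x', y') =
     (cmu C i j x x',
      if t \<le> i + j then
        cad C (i + j - t)
          (if t \<le> i then cmu C (i - t) j y x' else czr C (i + j - t))
          (if t \<le> j then csc C (i + j - t) ((-1) ^ i) (cmu C i (j - t) x y') else czr C (i + j - t))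
      else czr C 0)"
  by (simp add: theta_ext_def Let_def t_def)

lemma cdf_T:
  "cdf T i (x, y) =
     (cad C (Suc i) (cdf C i x) (if t \<le> i then cmu C (Suc t) (i - t) \<omega> y else czr C (Suc i)),
      if t \<le> Suc i then
        (if t \<le> i then csc C (Suc i - t) (-1) (cdf C (i - t) y) else czr C (Suc i - t))
      else czr C 0)"
  using two_n by (simp add: theta_ext_def Let_def t_def)

lemmas T_simps = cgr_T czr_T cad_T csc_T cun_T cmu_T cdf_T

text \<open>Below degree \<open>t\<close> there is no \<theta> component. From \<open>t\<close> on,
  writing \<open>i = t + i'\<close> removes the truncated subtractions from the formulas for
  \<open>T\<close>.\<close>

lemma degree_cases:
  obtains "i < t" | i' where "i = t + i'"
  using le_Suc_ex not_less by blast

section \<open>The CDGA axioms for the extension\<close>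

lemma neg_T:
  "u \<in> cgr T i \<Longrightarrow> csc T i (-1) u \<in> cgr T i \<and> cad T i u (csc T i (-1) u) = czr T i"
  by (cases u) (simp add: T_simps split: if_splits)

lemma is_vs_T: "is_vs T i"
proof -
  have "\<exists>v\<in>cgr T i. cad T i u v = czr T i" if "u \<in> cgr T i" for u
    using neg_T[OF that] by blast
  then show ?thesis
    unfolding is_vs_def Let_def
    apply (intro conjI)
    subgoal by (auto simp: T_simps)
    subgoal by (auto simp: T_simps)
    subgoal by (auto simp: T_simps)
    subgoal by (auto simp: T_simps add_assoc)
    subgoal by (auto simp: T_simps add_comm)
    subgoal by (auto simp: T_simps)
    subgoal by simp
    subgoal by (auto simp: T_simps)
    subgoal by (auto simp: T_simps)
    subgoal by (auto simp: T_simps scale_add)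
    subgoal by (auto simp: T_simps scale_plus)
    done
qed

lemma mult_closed_T: "u \<in> cgr T i \<Longrightarrow> v \<in> cgr T j \<Longrightarrow> cmu T i j u v \<in> cgr T (i+j)"
  by (cases u; cases v) (auto simp: T_simps split: if_splits)

lemma mult_add_left_T:
  "\<lbrakk>u \<in> cgr T i; u' \<in> cgr T i; v \<in> cgr T j\<rbrakk>
    \<Longrightarrow> cmu T i j (cad T i u u') v = cad T (i+j) (cmu T i j u v) (cmu T i j u' v)"
  by (cases i rule: degree_cases; cases j rule: degree_cases; cases u; cases u'; cases v)
    (simp_all add: T_simps mult_add_left scale_add add_ac ac_simps)

lemma mult_add_right_T:
  "\<lbrakk>u \<in> cgr T i; v \<in> cgr T j; v' \<in> cgr T j\<rbrakk>
    \<Longrightarrow> cmu T i j u (cad T j v v') = cad T (i+j) (cmu T i j u v) (cmu T i j u v')"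
  by (cases i rule: degree_cases; cases j rule: degree_cases; cases u; cases v; cases v')
    (simp_all add: T_simps mult_add_right scale_add add_ac ac_simps)

lemma mult_scale_T:
  assumes "u \<in> cgr T i" "v \<in> cgr T j"
  shows "cmu T i j (csc T i c u) v = csc T (i+j) c (cmu T i j u v)"
    and "cmu T i j u (csc T j c v) = csc T (i+j) c (cmu T i j u v)"
  using assms
  by (cases i rule: degree_cases; cases j rule: degree_cases; cases u; cases v;
      simp add: T_simps scale_add add_ac ac_simps)+

lemma mult_one_T:
  assumes "u \<in> cgr T i"
  shows "cmu T 0 i (cun T) u = u" "cmu T i 0 u (cun T) = u"
  using assms odd_t
  by (cases i rule: degree_cases; cases u; auto simp: T_simps)+

lemma mult_assoc_T:
  "\<lbrakk>u \<in> cgr T i; v \<in> cgr T j; w \<in> cgr T k\<rbrakk>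
    \<Longrightarrow> cmu T (i+j) k (cmu T i j u v) w = cmu T i (j+k) u (cmu T j k v w)"
  by (cases i rule: degree_cases; cases j rule: degree_cases; cases k rule: degree_cases;
      cases u; cases v; cases w)
    (simp_all add: T_simps mult_assoc mult_add_left mult_add_right scale_add add_ac
        ac_simps power_add)

lemma mult_comm_T:
  assumes "u \<in> cgr T i" "v \<in> cgr T j"
  shows "cmu T i j u v = csc T (i+j) ((-1) ^ (i*j)) (cmu T j i v u)"
proof -
  obtain x y x' y' where uv: "u = (x, y)" "v = (x', y')" by (cases u, cases v)
  \<comment> \<open>As \<open>t\<close> is odd, \<open>i * j\<close> and \<open>i' * j\<close>
    differ in parity by \<open>j\<close>; this is the sign of moving \<theta> past
    \<open>x'\<close>. The fact \<open>right\<close> is the mirror image.\<close>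
  have left: "cmu C i' j y x' = csc C (i'+j) ((-1) ^ (i*j) * (-1) ^ j) (cmu C j i' x' y)"
    if "i = t + i'" "y \<in> cgr C i'" "x' \<in> cgr C j" for i'
  proof -
    have "(-1 :: 'k) ^ (i' * j) = (-1) ^ (i*j) * (-1) ^ j"
      using that(1) odd_t by (simp add: minus_one_power_iff)
    then show ?thesis using mult_comm[OF that(2,3)] by simp
  qed
  have right: "cmu C i j' x y' = csc C (i+j') ((-1) ^ i * (-1) ^ (i*j)) (cmu C j' i y' x)"
    if "j = t + j'" "x \<in> cgr C i" "y' \<in> cgr C j'" for j'
  proof -
    have "(-1 :: 'k) ^ (i * j') = (-1) ^ i * (-1) ^ (i*j)"
      using that(1) odd_t by (simp add: minus_one_power_iff)
    then show ?thesis using mult_comm[OF that(2,3)] by simp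
  qed
  have first: "cmu C i j x x' = csc C (i+j) ((-1) ^ (i*j)) (cmu C j i x' x)"
    using assms unfolding uv by (intro mult_comm) (simp_all add: cgr_T)
  consider "i < t" "j < t" | i' where "i = t + i'" "j < t" | j' where "i < t" "j = t + j'"
    | i' j' where "i = t + i'" "j = t + j'"
    by (cases i rule: degree_cases; cases j rule: degree_cases) auto
  then show ?thesis
  proof cases
    case 1
    then show ?thesis using assms unfolding uv by (simp add: T_simps first ac_simps)
  next
    case 2
    then show ?thesis using assms first left[OF 2(1)] unfolding uv by (simp add: T_simps ac_simps)
  next
    case 3
    then show ?thesis using assms first right[OF 3(2)] unfolding uv by (simp add: T_simps ac_simps)
  next
    case 4
    then show ?thesis using assms first left[OF 4(1)] right[OF 4(2)] unfolding uv
      by (simp add: T_simps scale_add add_ac ac_simps)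
  qed
qed

lemma d_closed_T: "u \<in> cgr T i \<Longrightarrow> cdf T i u \<in> cgr T (Suc i)"
  by (cases i rule: degree_cases; cases u) (simp_all add: T_simps)

lemma d_add_T:
  "u \<in> cgr T i \<Longrightarrow> v \<in> cgr T i \<Longrightarrow> cdf T i (cad T i u v) = cad T (Suc i) (cdf T i u) (cdf T i v)"
  by (cases i rule: degree_cases; cases u; cases v)
    (simp_all add: T_simps d_add scale_add mult_add_right add_ac ac_simps)

lemma d_scale_T: "u \<in> cgr T i \<Longrightarrow> cdf T i (csc T i c u) = csc T (Suc i) c (cdf T i u)"
  by (cases i rule: degree_cases; cases u) (simp_all add: T_simps scale_add mult_ac)

text \<open>In the \<open>A\<close> component \<open>d (\<omega> y)\<close> cancels against
  \<open>\<omega> d y\<close>, because \<omega> is closed of even degree and the \<theta> component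
  of the differential is \<open>- d y\<close>.\<close>

lemma d_d_T:
  assumes "u \<in> cgr T i"
  shows "cdf T (Suc i) (cdf T i u) = czr T (Suc (Suc i))"
proof (cases "Suc i = t")
  \<comment> \<open>The differential enters degree \<open>t\<close> here, where the \<theta>
    component appears for the first time, as zero.\<close>
  case True
  then have "t = Suc i" by simp
  then show ?thesis using assms omega_closed by (cases u) (simp add: T_simps)
next
  case False
  then show ?thesis using assms
    by (cases i rule: degree_cases; cases u) (simp_all add: T_simps d_add d_mult odd_t)
qed

text \<open>The even degree of \<omega> makes it central without signs.\<close>

lemma mult_omega:
  assumes "x \<in> cgr C i" "y \<in> cgr C k" "m = Suc t + k"
  shows "cmu C i m x (cmu C (Suc t) k \<omega> y) = cmu C (Suc t) (i + k) \<omega> (cmu C i k x y)"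
proof -
  have "cmu C i m x (cmu C (Suc t) k \<omega> y) = cmu C (i + Suc t) k (cmu C i (Suc t) x \<omega>) y"
    using assms by (simp add: mult_assoc)
  also have "cmu C i (Suc t) x \<omega> = cmu C (Suc t) i \<omega> x"
    using mult_comm[of x i \<omega> "Suc t"] assms odd_t by simp
  finally show ?thesis using assms by (simp add: mult_assoc)
qed

lemma d_mult_T:
  assumes "u \<in> cgr T i" "v \<in> cgr T j"
  shows "cdf T (i+j) (cmu T i j u v) =
      cad T (Suc (i+j)) (cmu T (Suc i) j (cdf T i u) v)
                        (csc T (Suc (i+j)) ((-1) ^ i) (cmu T i (Suc j) u (cdf T j v)))"
proof -
  note simps = T_simps d_mult d_add mult_assoc mult_omega mult_add_left mult_add_right scale_add
    add_ac ac_simps power_add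
  obtain x y x' y' where uv: "u = (x, y)" "v = (x', y')" by (cases u, cases v)
  consider "i < t" "j < t" | i' where "i = t + i'" "j < t" | j' where "i < t" "j = t + j'"
    | i' j' where "i = t + i'" "j = t + j'"
    by (cases i rule: degree_cases; cases j rule: degree_cases) auto
  then show ?thesis
  proof cases
    case 1
    \<comment> \<open>Neither factor has a \<theta> component, yet a differential may land exactly
      in degree \<open>t\<close>, so these boundary degrees are split off.\<close>
    then show ?thesis using assms omega_closed unfolding uv
      by (cases "t = Suc i"; cases "t = Suc j") (auto simp: T_simps d_mult Suc_diff_le add.commute[of j i])
  next
    case 2
    show ?thesis
    proof (cases "Suc j = t")
      case True
      then show ?thesis using assms 2 unfolding uv by (simp add: simps)
    next
      case False
      then show ?thesis using assms 2 unfolding uv by (simp add: simps)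
    qed
  next
    case 3
    show ?thesis
    proof (cases "Suc i = t")
      case True
      then have deg: "Suc (k + i) = k + t" "Suc (i + k) = k + t" for k by simp_all
      have "even i" using True odd_t by (metis even_Suc)
      then show ?thesis using assms 3 True unfolding uv by (simp add: simps deg)
    next
      case False
      then show ?thesis using assms 3 unfolding uv by (simp add: simps)
    qed
  next
    case 4
    \<comment> \<open>The right-hand side contains \<open>\<omega> y y'\<close> in its \<theta>
      component twice, once from \<open>(d u) v\<close> and once from \<open>u (d v)\<close>, with
      opposite signs.\<close>
    have cancel: "cad C m (csc C m c w) (cad C m r (cad C m (csc C m (-c) w) s)) = cad C m r s"
      if "w \<in> cgr C m" "r \<in> cgr C m" "s \<in> cgr C m" for m c w r s
    proof -
      have "cad C m (csc C m c w) (csc C m (-c) w) = czr C m"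
        using scale_plus[of w m c "-c"] that by simp
      then have "cad C m (cad C m (csc C m c w) (csc C m (-c) w)) (cad C m r s) = cad C m r s"
        using that by simp
      then show ?thesis using that by (simp add: add_ac)
    qed
    show ?thesis using assms 4 unfolding uv by (simp add: simps cancel)
  qed
qed

lemma is_cdga_T: "is_cdga T"
  unfolding is_cdga_def
  using is_vs_T mult_closed_T mult_add_left_T mult_add_right_T mult_scale_T mult_one_T mult_assoc_T
    d_closed_T d_add_T d_scale_T d_d_T d_mult_T
  apply (intro conjI allI ballI)
  apply (simp_all add: cun_T cgr_T)
  apply (rule mult_comm_T; assumption)
  done

end

section \<open>Massey products in the extension and division by \<open>a\<close>\<close>

context gcdga_theta
begin

text \<open>Below degree \<open>t\<close> the second entry has to be the dummy that
  \<open>theta_ext\<close> prescribes.\<close>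

definition incl :: "nat \<Rightarrow> 'a \<Rightarrow> 'a \<times> 'a" where
  "incl i x = (x, if t \<le> i then czr C (i - t) else czr C 0)"

lemma incl_closed [simp]: "x \<in> cgr C i \<Longrightarrow> incl i x \<in> cgr T i"
  by (simp add: incl_def cgr_T)

lemma cmu_incl:
  "x \<in> cgr C i \<Longrightarrow> y \<in> cgr C j \<Longrightarrow> m = i + j \<Longrightarrow> cmu T i j (incl i x) (incl j y) = incl m (cmu C i j x y)"
  by (simp add: incl_def cmu_T)

lemma cdf_incl: "x \<in> cgr C i \<Longrightarrow> cdf T i (incl i x) = incl (Suc i) (cdf C i x)"
  by (cases "Suc i = t") (auto simp: incl_def cdf_T Suc_diff_le)

lemma incl_cocycle: "x \<in> cocycles C i \<Longrightarrow> incl i x \<in> cocycles T i"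
  by (simp add: cocycles_def cdf_incl) (simp add: incl_def czr_T)

lemma incl_coboundary:
  assumes "x \<in> coboundaries C (Suc i)"
  shows "incl (Suc i) x \<in> coboundaries T (Suc i)"
proof -
  interpret T: gcdga T by standard (rule is_cdga_T)
  show ?thesis using assms by (auto simp: coboundaries_Suc T.coboundaries_Suc cdf_incl[symmetric])
qed

text \<open>Write the primitives of \<open>a b\<close> and \<open>b z\<close> as
  \<open>p0 + \<theta> p1\<close> and \<open>q0 + \<theta> q1\<close>. Connectedness and the
  nontriviality of \<omega> force \<open>p1 = 1\<close>, whatever primitives were supplied, and
  \<open>q1\<close> is closed. The \<theta> component of the Massey cocycle is then
  \<open>z - a q1\<close>, so \<open>w = - q1\<close> works.\<close>

lemma massey_division:
  assumes massey: "massey_trivial T"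
    and connected: "\<And>u. u \<in> cocycles C 0 \<Longrightarrow> \<exists>c. u = csc C 0 c (cun C)"
    and omega_nontrivial: "\<omega> \<notin> coboundaries C (2 * n)"
    and a: "a \<in> cocycles C (Suc i)" and b: "b \<in> cocycles C j" and z: "z \<in> cocycles C (Suc (i + r))"
    and deg: "Suc i + j = 2 * n"
    and e: "e \<in> coboundaries C (2 * n)" and ab: "cmu C (Suc i) j a b = cad C (2 * n) \<omega> e"
    and bz: "cmu C j (Suc (i + r)) b z \<in> coboundaries C (Suc (i + j + r))"
  obtains w where "w \<in> cocycles C r"
    and "cad C (Suc (i + r)) z (cmu C (Suc i) r a w) \<in> coboundaries C (Suc (i + r))"
    and "r = 0 \<Longrightarrow> w = czr C 0"
proof -
  interpret T: gcdga T by standard (rule is_cdga_T)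
  have ij: "i + j = t" using deg two_n by simp
  note [simp] = cocyclesD[OF a] cocyclesD[OF b] cocyclesD[OF z]
  have e_closed [simp]: "e \<in> cgr C (Suc t)" using coboundary_closed[OF e] two_n by simp
  \<comment> \<open>Used twice: to pin down the scalar \<open>p1\<close>, and to kill
    \<open>q1\<close> when \<open>r = 0\<close>.\<close>
  have scale_omega: "c = 0" if "csc C (Suc t) c \<omega> \<in> coboundaries C (Suc t)" for c
  proof (rule ccontr)
    assume "c \<noteq> 0"
    then have "csc C (Suc t) (inverse c) (csc C (Suc t) c \<omega>) = \<omega>" by simp
    then show False using scale_coboundary[OF that, of "inverse c"] omega_nontrivial two_n by simp
  qed
  have omega_one: "cmu C (Suc t) 0 \<omega> (csc C 0 c (cun C)) = csc C (Suc t) c \<omega>" for c by simp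
  have "incl (Suc t) (cad C (Suc t) \<omega> e) \<in> coboundaries T (Suc t)"
  proof -
    obtain e' where e': "e' \<in> cgr C t" "e = cdf C t e'"
      using e two_n by (auto simp: coboundaries_Suc)
    \<comment> \<open>The pair is \<open>e' + \<theta>\<close>, and
      \<open>d (e' + \<theta>) = e + \<omega>\<close>.\<close>
    have "incl (Suc t) (cad C (Suc t) \<omega> e) = cdf T t (e', cun C)"
      using e' by (simp add: incl_def cdf_T add_comm)
    moreover have "(e', cun C) \<in> cgr T t" using e' by (simp add: cgr_T)
    ultimately show ?thesis by (auto simp: T.coboundaries_Suc)
  qed
  then have ab_T: "cmu T (Suc i) j (incl (Suc i) a) (incl j b) \<in> coboundaries T (Suc (i + j))"
    using ab by (simp add: cmu_incl ij two_n)
  have jr: "j + (i + r) = t + r" using ij by simp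
  have bz_T: "cmu T j (Suc (i + r)) (incl j b) (incl (Suc (i + r)) z) \<in> coboundaries T (Suc (j + (i + r)))"
    using incl_coboundary[OF bz] by (simp add: cmu_incl ac_simps)
  have "massey_vanishes T i j (i + r) (incl (Suc i) a) (incl j b) (incl (Suc (i + r)) z)"
    using massey ab_T bz_T incl_cocycle[OF a] incl_cocycle[OF b] incl_cocycle[OF z]
    unfolding massey_trivial_def by blast
  then obtain P Q where P: "P \<in> cgr T t" and Q: "Q \<in> cgr T (t + r)"
    and dP: "cdf T t P = cmu T (Suc i) j (incl (Suc i) a) (incl j b)"
    and dQ: "cdf T (t + r) Q = cmu T j (Suc (i + r)) (incl j b) (incl (Suc (i + r)) z)"
    and PQ: "cad T (Suc (t + (i + r))) (cmu T t (Suc (i + r)) P (incl (Suc (i + r)) z))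
      (csc T (Suc (t + (i + r))) ((-1) ^ i) (cmu T (Suc i) (t + r) (incl (Suc i) a) Q))
      \<in> coboundaries T (Suc (t + (i + r)))"
    unfolding massey_vanishes_def ij jr by blast
  obtain p0 p1 q0 q1 where pq: "P = (p0, p1)" "Q = (q0, q1)" by (cases P, cases Q)
  have p [simp]: "p0 \<in> cgr C t" "p1 \<in> cgr C 0" and q [simp]: "q0 \<in> cgr C (t + r)" "q1 \<in> cgr C r"
    using P Q by (simp_all add: pq cgr_T)
  \<comment> \<open>The \<theta> component of a differential carries a minus sign, so comparing
    components yields only \<open>- d p1 = 0\<close> and \<open>- d q1 = 0\<close>.\<close>
  have neg: "x = czr C m" if "csc C m (-1) x = czr C m" "x \<in> cgr C m" for x m
    using scale_scale[of x m "-1" "-1"] that by simp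
  have ab': "cmu C (Suc i) j a b = cad C (Suc t) \<omega> e" using ab two_n by simp
  have dp: "cad C (Suc t) (cdf C t p0) (cmu C (Suc t) 0 \<omega> p1) = cad C (Suc t) \<omega> e"
    and dp1: "cdf C 0 p1 = czr C (Suc 0)"
  proof -
    have "cdf T t P = incl (Suc t) (cad C (Suc t) \<omega> e)" using dP by (simp add: cmu_incl ij ab')
    then show "cad C (Suc t) (cdf C t p0) (cmu C (Suc t) 0 \<omega> p1) = cad C (Suc t) \<omega> e"
      and "cdf C 0 p1 = czr C (Suc 0)"
      using neg[of "Suc 0" "cdf C 0 p1"] by (simp_all add: pq cdf_T incl_def)
  qed
  have "p1 \<in> cocycles C 0" using dp1 by (simp add: cocycles_def)
  then obtain c where c: "p1 = csc C 0 c (cun C)" using connected by blast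
  \<comment> \<open>From \<open>d p0 + c \<omega> = \<omega> + e\<close>: the multiple
    \<open>(1 - c) \<omega>\<close> is exact, which forces \<open>c = 1\<close>.\<close>
  have "cad C (Suc t) (cdf C t p0) (csc C (Suc t) (-1) e) = csc C (Suc t) (1 - c) \<omega>"
  proof -
    have "cdf C t p0 = cad C (Suc t) (cad C (Suc t) \<omega> e) (csc C (Suc t) (-c) \<omega>)"
      using dp add_eq_iff[of "cdf C t p0" "Suc t" "csc C (Suc t) c \<omega>" "cad C (Suc t) \<omega> e"]
      unfolding c omega_one by simp
    then have "cad C (Suc t) (cdf C t p0) (csc C (Suc t) (-1) e) =
        cad C (Suc t) (cad C (Suc t) \<omega> (csc C (Suc t) (-c) \<omega>)) (cad C (Suc t) e (csc C (Suc t) (-1) e))"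
      by (simp add: add_ac del: add_neg)
    then show ?thesis using scale_plus[of \<omega> "Suc t" 1 "-c"] by simp
  qed
  moreover have "cad C (Suc t) (cdf C t p0) (csc C (Suc t) (-1) e) \<in> coboundaries C (Suc t)"
    using e two_n by (intro add_coboundary scale_coboundary) (auto simp: coboundaries_Suc)
  ultimately have "1 - c = 0" using scale_omega[of "1 - c"] by simp
  then have p1: "p1 = cun C" using c by simp
  have dq: "cad C (Suc (t + r)) (cdf C (t + r) q0) (cmu C (Suc t) r \<omega> q1) = cmu C j (Suc (i + r)) b z"
    and dq1: "cdf C r q1 = czr C (Suc r)"
  proof -
    have "cdf T (t + r) Q = incl (Suc (t + r)) (cmu C j (Suc (i + r)) b z)"
      using dQ jr by (simp add: cmu_incl)
    then show "cad C (Suc (t + r)) (cdf C (t + r) q0) (cmu C (Suc t) r \<omega> q1) = cmu C j (Suc (i + r)) b z"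
      and "cdf C r q1 = czr C (Suc r)"
      using neg[of "Suc r" "cdf C r q1"] by (simp_all add: pq cdf_T incl_def)
  qed
  then have q1: "q1 \<in> cocycles C r" by (simp add: cocycles_def)
  \<comment> \<open>For \<open>r = 0\<close> the cocycle \<open>q1\<close> is a scalar
    \<open>c\<close>, and \<open>d q0 + c \<omega> = b z\<close> with \<open>b z\<close> exact in
    \<open>C\<close> forces \<open>c = 0\<close>.\<close>
  have q1_0: "q1 = czr C 0" if r0: "r = 0"
  proof -
    obtain c where c: "q1 = csc C 0 c (cun C)" using connected q1 r0 by blast
    have "cad C (Suc t) (csc C (Suc t) c \<omega>) (cdf C t q0) \<in> coboundaries C (Suc t)"
      using dq bz r0 q(1) add_comm[of "csc C (Suc t) c \<omega>" "Suc t" "cdf C t q0"]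
      unfolding c by (simp add: ij)
    then have "csc C (Suc t) c \<omega> \<in> coboundaries C (Suc t)"
      using r0 q(1) by (subst (asm) add_coboundary_iff) (auto simp: coboundaries_Suc)
    then show ?thesis using c scale_omega[of c] by simp
  qed
  obtain x' y' where xy: "(x', y') \<in> cgr T (t + (i + r))"
    "cad T (Suc (t + (i + r))) (cmu T t (Suc (i + r)) P (incl (Suc (i + r)) z))
      (csc T (Suc (t + (i + r))) ((-1) ^ i) (cmu T (Suc i) (t + r) (incl (Suc i) a) Q))
      = cdf T (t + (i + r)) (x', y')"
    using PQ by (auto simp: T.coboundaries_Suc)
  have y': "y' \<in> cgr C (i + r)" using xy(1) by (simp add: cgr_T)
  \<comment> \<open>The \<theta> component of the exactness equation. Moving \<theta> past
    \<open>a\<close> costs \<open>(-1)^(i+1)\<close>, which together with the Massey sign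
    \<open>(-1)^i\<close> gives \<open>- a q1\<close>; on the right stands
    \<open>- d y'\<close>.\<close>
  have "cad C (Suc (i + r)) z (csc C (Suc (i + r)) (-1) (cmu C (Suc i) r a q1))
      = csc C (Suc (i + r)) (-1) (cdf C (i + r) y')"
  proof -
    have Pz: "snd (cmu T t (Suc (i + r)) P (incl (Suc (i + r)) z)) = z"
      by (simp add: pq p1 incl_def cmu_T)
    have aQ: "snd (cmu T (Suc i) (t + r) (incl (Suc i) a) Q)
        = csc C (Suc (i + r)) (- ((-1) ^ i)) (cmu C (Suc i) r a q1)"
      by (simp add: pq incl_def cmu_T)
    have snd_T: "snd (cad T (Suc (t + m)) u (csc T (Suc (t + m)) c v))
        = cad C (Suc m) (snd u) (csc C (Suc m) c (snd v))" for m c u v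
      by (cases u; cases v) (simp add: cad_T csc_T)
    show ?thesis
      using arg_cong[OF xy(2), of snd] unfolding snd_T Pz aQ by (simp add: cdf_T)
  qed
  moreover have "csc C (Suc (i + r)) (-1) (cdf C (i + r) y') \<in> coboundaries C (Suc (i + r))"
    using y' by (intro scale_coboundary) (simp add: coboundaries_Suc)
  ultimately have "cad C (Suc (i + r)) z (cmu C (Suc i) r a (csc C r (-1) q1))
      \<in> coboundaries C (Suc (i + r))" by simp
  then show ?thesis using that[of "csc C r (-1) q1"] q1 q1_0 by auto
qed

end

subsection \<open>Algebras generated by one element\<close>

lemma ptrunc_monom: "ptrunc p (monom c m) = (if m < p then monom c m else 0)"
proof -
  have "ptrunc p (monom c m) = (\<Sum>i<p. if m = i then monom c i else 0)"
    unfolding ptrunc_def by (intro sum.cong) auto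
  then show ?thesis by simp
qed

text \<open>Collects what the main proof establishes for \<open>cohom A\<close>: a scalar degree 0,
  a gap up to degree \<open>k\<close>, divisibility by \<open>x\<close> from degree \<open>k\<close>
  on, and vanishing above \<open>N\<close>.\<close>

locale monogenic = gcdga H for H :: "('k::field, 'a) cdga" +
  fixes k N :: nat and x :: 'a
  assumes d_trivial: "\<And>i z. z \<in> cgr H i \<Longrightarrow> cdf H i z = czr H (Suc i)"
    and k_pos: "0 < k" and x [simp]: "x \<in> cgr H k"
    and unit: "cun H \<noteq> czr H 0" "\<And>z. z \<in> cgr H 0 \<Longrightarrow> \<exists>c. z = csc H 0 c (cun H)"
    and above: "\<And>i. N < i \<Longrightarrow> cgr H i = {czr H i}"
    and gap: "\<And>i. 0 < i \<Longrightarrow> i < k \<Longrightarrow> cgr H i = {czr H i}"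
    and generated: "\<And>i z. k \<le> i \<Longrightarrow> z \<in> cgr H i \<Longrightarrow> \<exists>w\<in>cgr H (i - k). z = cmu H k (i - k) x w"
begin

primrec xp :: "nat \<Rightarrow> 'a" where
  "xp 0 = cun H"
| "xp (Suc m) = cmu H k (m * k) x (xp m)"

lemma xp_closed [simp]: "d = m * k \<Longrightarrow> xp m \<in> cgr H d"
  by (induction m arbitrary: d) auto

lemma xp_mult: "cmu H (i * k) (j * k) (xp i) (xp j) = xp (i + j)"
  by (induction i) (simp_all add: mult_assoc flip: add_mult_distrib)

text \<open>Strong induction: dividing by \<open>x\<close> lowers the degree by \<open>k > 0\<close>
  until degree 0 or the gap is reached.\<close>

lemma spanned:
  "z \<in> cgr H d \<Longrightarrow> z = czr H d \<or> (\<exists>m c. d = m * k \<and> z = csc H d c (xp m))"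
proof (induction d arbitrary: z rule: less_induct)
  case (less d)
  consider "d = 0" | "0 < d" "d < k" | "k \<le> d" by linarith
  then show ?case
  proof cases
    case 1
    then have "d = 0 * k" "\<exists>c. z = csc H d c (xp 0)" using less.prems unit(2) by auto
    then show ?thesis by blast
  next
    case 2
    then show ?thesis using less.prems gap by auto
  next
    case 3
    then obtain w where w: "w \<in> cgr H (d - k)" "z = cmu H k (d - k) x w"
      using generated less.prems by blast
    have "d - k < d" using 3 k_pos by simp
    from less.IH[OF this w(1)] show ?thesis
    proof (elim disjE exE conjE)
      assume "w = czr H (d - k)"
      then show ?thesis using w 3 by simp
    next
      fix m c assume m: "d - k = m * k" "w = csc H (d - k) c (xp m)"
      have d: "d = Suc m * k" using m(1) 3 by simp
      then have "z = csc H d c (xp (Suc m))" using w m by simp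
      then show ?thesis using d by blast
    qed
  qed
qed

definition p :: nat where "p = (LEAST m. xp m = czr H (m * k))"

lemma xp_p: "xp p = czr H (p * k)"
proof -
  \<comment> \<open>\<open>xp (Suc N)\<close> has degree above \<open>N\<close>, hence is zero; so
    the least exponent \<open>p\<close> exists.\<close>
  have "Suc N * 1 \<le> Suc N * k" using k_pos by (intro mult_le_mono2) simp
  then have "cgr H (Suc N * k) = {czr H (Suc N * k)}" by (intro above) simp
  then have "xp (Suc N) = czr H (Suc N * k)" using xp_closed[OF refl, of "Suc N"] by simp
  then show ?thesis unfolding p_def by (rule LeastI)
qed

lemma xp_eq_zero_iff: "xp m = czr H (m * k) \<longleftrightarrow> p \<le> m"
proof
  assume "p \<le> m"
  then show "xp m = czr H (m * k)"
    using xp_mult[of p "m - p"] by (simp add: xp_p flip: add_mult_distrib)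
qed (simp add: p_def Least_le)

lemma p_pos: "0 < p"
  using xp_eq_zero_iff[of 0] unit(1) by auto

lemma scale_inj:
  assumes "v \<in> cgr H d" "v \<noteq> czr H d" "csc H d c v = csc H d e v"
  shows "c = e"
proof (rule ccontr)
  assume "c \<noteq> e"
  have "csc H d (c - e) v = czr H d"
    using scale_plus[of v d c "-e"] scale_plus[of v d e "-e"] assms by simp
  then have "csc H d (inverse (c - e) * (c - e)) v = czr H d"
    using scale_scale[OF assms(1), of "inverse (c - e)" "c - e"] by simp
  then show False using \<open>c \<noteq> e\<close> assms by simp
qed

lemma element_cases:
  assumes "z \<in> cgr H d"
  obtains m c where "m < p" "d = m * k" "z = csc H d c (xp m)"
  | "\<forall>m<p. d \<noteq> m * k" "z = czr H d"
proof (cases "\<exists>m<p. d = m * k")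
  case True
  then obtain m where m: "m < p" "d = m * k" by blast
  from spanned[OF assms] show ?thesis
  proof (elim disjE exE conjE)
    assume "z = czr H d"
    then have "z = csc H d 0 (xp m)" using m by simp
    then show ?thesis using that m by blast
  next
    fix m' c assume "d = m' * k" "z = csc H d c (xp m')"
    moreover then have "m' = m" using m k_pos by simp
    ultimately show ?thesis using that m by blast
  qed
next
  case False
  from spanned[OF assms] have "z = czr H d"
  proof (elim disjE exE conjE)
    fix m c assume "d = m * k" "z = csc H d c (xp m)"
    then show ?thesis using False xp_eq_zero_iff[of m] not_less by auto
  qed
  then show ?thesis using that False by blast
qed

text \<open>As \<open>k > 0\<close>, each degree contains at most one power of \<open>x\<close>.
  Below \<open>p\<close> that power is nonzero, so by \<open>scale_inj\<close> the chosen
  coefficient is unique.\<close>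

definition coord :: "nat \<Rightarrow> 'a \<Rightarrow> 'k poly" where
  "coord d z = (if k dvd d \<and> d div k < p
     then monom (SOME c. z = csc H d c (xp (d div k))) (d div k) else 0)"

lemma coord_scale_xp:
  assumes "m < p" "d = m * k"
  shows "coord d (csc H d c (xp m)) = monom c m"
proof -
  have "(SOME e. csc H d c (xp m) = csc H d e (xp m)) = c"
    using assms xp_eq_zero_iff[of m] scale_inj[of "xp m" d] by (intro some_equality) auto
  then show ?thesis using assms k_pos by (simp add: coord_def)
qed

lemma coord_zero [simp]: "coord d (czr H d) = 0"
proof (cases "\<exists>m<p. d = m * k")
  case True
  then obtain m where m: "m < p" "d = m * k" by blast
  then show ?thesis using coord_scale_xp[of m d 0] by simp
next
  case False
  then show ?thesis by (auto simp: coord_def)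
qed

lemma is_hom_coord: "is_hom H (trunc_poly k p) coord"
  unfolding is_hom_def
proof (intro conjI allI ballI)
  fix d z assume "z \<in> cgr H d"
  then show "coord d z \<in> cgr (trunc_poly k p) d"
    by (cases rule: element_cases) (auto simp: coord_scale_xp trunc_poly_def)
next
  fix d z w assume zw: "z \<in> cgr H d" "w \<in> cgr H d"
  show "coord d (cad H d z w) = cad (trunc_poly k p) d (coord d z) (coord d w)"
    using zw(1)
  proof (cases rule: element_cases)
    case (1 m c)
    show ?thesis using zw(2)
    proof (cases rule: element_cases)
      case (1 m' c')
      with \<open>d = m * k\<close> k_pos have "m' = m" by simp
      then have "cad H d z w = csc H d (c + c') (xp m)"
        using 1 \<open>z = _\<close> by (simp add: scale_plus)
      then show ?thesis using 1 \<open>z = _\<close> \<open>m' = m\<close>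
        by (simp add: coord_scale_xp trunc_poly_def add_monom)
    qed (use 1 in auto)
  next
    case 2
    then show ?thesis using zw by (simp add: trunc_poly_def)
  qed
next
  fix d c z assume "z \<in> cgr H d"
  then show "coord d (csc H d c z) = csc (trunc_poly k p) d c (coord d z)"
  proof (cases rule: element_cases)
    case (1 m e)
    then have "csc H d c z = csc H d (c * e) (xp m)" by simp
    then show ?thesis using 1 by (simp add: coord_scale_xp trunc_poly_def smult_monom)
  next
    case 2
    then show ?thesis by (simp add: trunc_poly_def)
  qed
next
  fix i j z w assume zw: "z \<in> cgr H i" "w \<in> cgr H j"
  show "coord (i + j) (cmu H i j z w) = cmu (trunc_poly k p) i j (coord i z) (coord j w)"
    using zw(1)
  proof (cases rule: element_cases)
    case z: (1 m c)
    show ?thesis using zw(2)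
    proof (cases rule: element_cases)
      case w: (1 m' c')
      have deg: "i + j = (m + m') * k" using z w by (simp add: add_mult_distrib)
      then have mem: "xp (m + m') \<in> cgr H (m * k + m' * k)" using z w by simp
      have prod: "cmu H i j z w = csc H (i + j) (c * c') (xp (m + m'))"
        using z w xp_mult[of m m'] mem by (simp add: mult.commute[of c'])
      show ?thesis
      \<comment> \<open>From exponent \<open>p\<close> on, the power of \<open>x\<close> vanishes in
        \<open>H\<close> just as \<open>ptrunc\<close> discards the monomial.\<close>
      proof (cases "m + m' < p")
        case True
        then show ?thesis unfolding prod using z w deg
          by (simp add: coord_scale_xp trunc_poly_def mult_monom ptrunc_monom del: mult_scale)
      next
        case False
        then have "xp (m + m') = czr H (i + j)" using xp_eq_zero_iff[of "m + m'"] deg by simp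
        then show ?thesis unfolding prod using False z w
          by (simp add: coord_scale_xp trunc_poly_def mult_monom ptrunc_monom)
      qed
    next
      case 2
      then show ?thesis using zw by (simp add: trunc_poly_def ptrunc_def)
    qed
  next
    case 2
    then show ?thesis using zw by (simp add: trunc_poly_def ptrunc_def)
  qed
next
  show "coord 0 (cun H) = cun (trunc_poly k p)"
    using coord_scale_xp[of 0 0 1] p_pos by (simp add: trunc_poly_def)
next
  fix d z assume "z \<in> cgr H d"
  then show "coord (Suc d) (cdf H d z) = cdf (trunc_poly k p) d (coord d z)"
    by (simp add: d_trivial trunc_poly_def)
qed

lemma bij_coord: "bij_betw (coord d) (cgr H d) (cgr (trunc_poly k p) d)"
proof (rule bij_betwI')
  fix z w assume "z \<in> cgr H d" "w \<in> cgr H d"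
  then show "coord d z = coord d w \<longleftrightarrow> z = w"
    using k_pos
    by (elim element_cases) (auto simp: coord_scale_xp dest: arg_cong[of _ _ "coord d"])
next
  fix z assume "z \<in> cgr H d"
  then show "coord d z \<in> cgr (trunc_poly k p) d"
    using is_hom_coord unfolding is_hom_def by meson
next
  fix f :: "'k poly" assume f: "f \<in> cgr (trunc_poly k p) d"
  then have f: "\<And>i. coeff f i \<noteq> 0 \<Longrightarrow> i < p \<and> i * k = d" by (simp add: trunc_poly_def)
  show "\<exists>z\<in>cgr H d. f = coord d z"
  proof (cases "\<exists>m<p. d = m * k")
    case True
    then obtain m where m: "m < p" "d = m * k" by blast
    have "f = monom (coeff f m) m"
    proof (rule poly_eqI)
      fix i show "coeff f i = coeff (monom (coeff f m) m) i"
        using f[of i] m k_pos by (cases "i = m") auto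
    qed
    then have "f = coord d (csc H d (coeff f m) (xp m))" using m by (simp add: coord_scale_xp)
    then show ?thesis using m by (intro bexI) auto
  next
    case False
    then have "f = 0" using f by (intro poly_eqI) (metis coeff_0)
    then show ?thesis by (intro bexI[of _ "czr H d"]) auto
  qed
qed

lemma iso_trunc_poly: "cdga_iso H (trunc_poly k p)"
  unfolding cdga_iso_def using is_hom_coord bij_coord by blast

end

subsection \<open>Poincare duality\<close>

context gcdga
begin

text \<open>\<open>one_dim\<close> only provides some generator \<open>v\<close>. If the unit were
  zero, \<open>v = 1 * v\<close> would be zero; so the unit is a nonzero multiple of
  \<open>v\<close> and generates as well.\<close>

lemma one_dim_unit:
  assumes "one_dim C 0"
  shows "cun C \<noteq> czr C 0" and "z \<in> cgr C 0 \<Longrightarrow> \<exists>c. z = csc C 0 c (cun C)"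
proof -
  obtain v where v: "v \<in> cgr C 0" "v \<noteq> czr C 0" "\<And>w. w \<in> cgr C 0 \<Longrightarrow> \<exists>c. w = csc C 0 c v"
    using assms unfolding one_dim_def by blast
  show ne: "cun C \<noteq> czr C 0"
    using v(1,2) by (metis mult_one(1) mult_zero_left add_0)
  obtain c where c: "cun C = csc C 0 c v" using v(3) one_closed by blast
  have "c \<noteq> 0" using ne c v by auto
  then have "csc C 0 (inverse c) (cun C) = v" using v c by simp
  then show "\<exists>e. z = csc C 0 e (cun C)" if "z \<in> cgr C 0"
    using v(3)[OF that] by (metis one_closed scale_scale)
qed

lemma connected_cocycles:
  assumes "connected C" "u \<in> cocycles C 0"
  shows "\<exists>c. u = csc C 0 c (cun C)"
proof -
  interpret H: gcdga "cohom C" by standard (rule is_cdga_cohom)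
  have "coset C 0 u \<in> cgr (cohom C) 0" using assms(2) by (simp add: cgr_cohom)
  then obtain c where "coset C 0 u = csc (cohom C) 0 c (cun (cohom C))"
    using H.one_dim_unit(2) assms(1) unfolding connected_def by blast
  then have "coset C 0 u = coset C 0 (csc C 0 c (cun C))" by (simp add: cun_cohom csc_cohom)
  \<comment> \<open>No nonzero coboundaries exist in degree 0, so equality of classes there is
    equality of cocycles.\<close>
  moreover have "coset C 0 v = {v}" if "v \<in> cgr C 0" for v
    using that by (auto simp: coset_def coboundaries_0)
  ultimately have "u = csc C 0 c (cun C)" using cocyclesD(1)[OF assms(2)] by simp
  then show ?thesis by blast
qed

lemma lin_fun_zero: "lin_fun C m \<phi> \<Longrightarrow> \<phi> (czr C m) = 0"
  unfolding lin_fun_def by (metis mult_zero_class.mult_zero_left scale_zero zero_closed)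

text \<open>If all pairings with \<open>x\<close> vanished, \<open>x\<close> and zero would give the
  same functional, against injectivity of the duality map.\<close>

lemma poincare_nondegenerate:
  assumes P: "poincare_alg C m \<alpha>" and i: "i \<le> m" and x: "x \<in> cgr C i" "x \<noteq> czr C i"
  shows "\<exists>y\<in>cgr C (m - i). \<alpha> (cmu C i (m - i) x y) \<noteq> 0"
proof (rule ccontr)
  assume "\<not> ?thesis"
  moreover have "\<alpha> (czr C m) = 0"
    using P lin_fun_zero by (simp add: poincare_alg_def dual_def)
  then have "\<alpha> (cmu C i (m - i) (czr C i) y) = 0" if "y \<in> cgr C (m - i)" for y
    using that i mult_zero_left[of y "m - i" m i] by simp
  ultimately have "restrict (\<lambda>y. \<alpha> (cmu C i (m - i) x y)) (cgr C (m - i)) =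
      restrict (\<lambda>y. \<alpha> (cmu C i (m - i) (czr C i) y)) (cgr C (m - i))"
    by (auto simp: restrict_def)
  moreover have "inj_on (\<lambda>x. restrict (\<lambda>y. \<alpha> (cmu C i (m - i) x y)) (cgr C (m - i))) (cgr C i)"
    using P i unfolding poincare_alg_def bij_betw_def by blast
  ultimately have "x = czr C i"
    using x(1) zero_closed by (rule_tac inj_onD)
  then show False using x(2) by simp
qed

end

section \<open>Generating the cohomology by a class of minimal positive degree\<close>

theorem theorem3p9:
  fixes A :: "('k::field_char_0, 'a) cdga" and n :: nat and \<omega> :: 'a and \<alpha> :: "'a set \<Rightarrow> 'k"
  assumes "1 \<le> n"
    and "is_cdga A"
    and "poincare_alg (cohom A) (2 * n) \<alpha>"
    and "formal TYPE('b) A"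
    and "connected A"
    and "\<omega> \<in> cgr A (2 * n)"
    and "cdf A (2 * n) \<omega> = czr A (Suc (2 * n))"
    and "\<alpha> (coset A (2 * n) \<omega>) = 1"
    and "formal TYPE('c) (theta_ext A n \<omega>)"
  shows "\<exists>k p. cdga_iso (cohom A) (trunc_poly k p :: ('k, 'k poly) cdga)"
proof -
  interpret gcdga_theta A n \<omega>
    using assms by unfold_locales (auto simp: cocycles_def)
  interpret H: gcdga "cohom A" by standard (rule is_cdga_cohom)
  let ?H = "cohom A" and ?N = "2 * n" and ?c = "coset A (2 * n) \<omega>"
  note P = assms(3)
  have massey: "massey_trivial T"
    using formal_imp_massey_trivial[OF is_cdga_T assms(9)] .
  have above: "cgr ?H i = {czr ?H i}" if "?N < i" for i
    using P that by (simp add: poincare_alg_def)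
  have lin: "lin_fun ?H ?N \<alpha>" using P by (simp add: poincare_alg_def dual_def)
  then have \<alpha>_add: "\<alpha> (cad ?H ?N X Y) = \<alpha> X + \<alpha> Y" and \<alpha>_scale: "\<alpha> (csc ?H ?N c X) = c * \<alpha> X"
    if "X \<in> cgr ?H ?N" "Y \<in> cgr ?H ?N" for X Y c
    using that unfolding lin_fun_def by meson+
  have unit: "cun ?H \<noteq> czr ?H 0" "Z \<in> cgr ?H 0 \<Longrightarrow> \<exists>c. Z = csc ?H 0 c (cun ?H)" for Z
    using H.one_dim_unit assms(5) unfolding connected_def by blast+
  \<comment> \<open>A nonzero top class pairs nontrivially with degree 0, which consists of scalars,
    so \<alpha> itself is nonzero on it.\<close>
  have \<alpha>_inj: "X = czr ?H ?N" if X: "X \<in> cgr ?H ?N" "\<alpha> X = 0" for X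
  proof (rule ccontr)
    assume "X \<noteq> czr ?H ?N"
    then obtain Y where Y: "Y \<in> cgr ?H 0" "\<alpha> (cmu ?H ?N 0 X Y) \<noteq> 0"
      using H.poincare_nondegenerate[OF P le_refl X(1)] by auto
    then obtain c where "Y = csc ?H 0 c (cun ?H)" using unit by blast
    then show False using Y X \<alpha>_scale[OF X(1) X(1)] by simp
  qed
  have c: "?c \<in> cgr ?H ?N" using omega by (simp add: cgr_cohom)
  have c_ne: "?c \<noteq> czr ?H ?N" using assms(8) H.lin_fun_zero[OF lin] by auto
  have omega_nontrivial: "\<omega> \<notin> coboundaries A ?N"
    using c_ne assms(6) by (simp add: czr_cohom coset_eq_zero_iff)
  define k where "k = (LEAST d. 0 < d \<and> cgr ?H d \<noteq> {czr ?H d})"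
  \<comment> \<open>The nonzero class of \<omega> shows that the least degree exists and is at most
    \<open>?N\<close>.\<close>
  have N_ok: "0 < ?N \<and> cgr ?H ?N \<noteq> {czr ?H ?N}" using c c_ne assms(1) by auto
  have k: "0 < k \<and> cgr ?H k \<noteq> {czr ?H k}" unfolding k_def using N_ok by (rule LeastI)
  have k_le: "k \<le> ?N" unfolding k_def using N_ok by (rule Least_le)
  have gap: "cgr ?H i = {czr ?H i}" if "0 < i" "i < k" for i
    using not_less_Least[of i "\<lambda>d. 0 < d \<and> cgr ?H d \<noteq> {czr ?H d}"] that unfolding k_def by blast
  obtain X where X: "X \<in> cgr ?H k" "X \<noteq> czr ?H k"
    using k H.zero_closed[of k] by blast
  \<comment> \<open>Rescale a class pairing nontrivially with \<open>X\<close> so that the product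
    has \<alpha>-value 1; injectivity of \<alpha> in top degree then identifies the product with
    \<open>?c\<close>.\<close>
  obtain Y where Y: "Y \<in> cgr ?H (?N - k)" "cmu ?H k (?N - k) X Y = ?c"
  proof -
    obtain Y where Y: "Y \<in> cgr ?H (?N - k)" "\<alpha> (cmu ?H k (?N - k) X Y) \<noteq> 0"
      using H.poincare_nondegenerate[OF P k_le X] by blast
    let ?a = "\<alpha> (cmu ?H k (?N - k) X Y)"
    let ?Y = "csc ?H (?N - k) (inverse ?a) Y"
    have mem: "cmu ?H k (?N - k) X Y \<in> cgr ?H ?N" using X Y k_le by simp
    have XY: "cmu ?H k (?N - k) X ?Y = csc ?H ?N (inverse ?a) (cmu ?H k (?N - k) X Y)"
      using X Y k_le by simp
    have "cad ?H ?N (cmu ?H k (?N - k) X ?Y) (csc ?H ?N (-1) ?c) = czr ?H ?N"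
      using mem c Y(2) assms(8) unfolding XY
      by (intro \<alpha>_inj) (simp_all add: \<alpha>_add \<alpha>_scale)
    then have "cmu ?H k (?N - k) X ?Y = ?c"
      using H.add_eq_iff[of "cmu ?H k (?N - k) X ?Y" ?N "csc ?H ?N (-1) ?c" "czr ?H ?N"] mem c XY
      by simp
    then show ?thesis by (rule that[rotated]) (use Y(1) in simp)
  qed
  obtain a where a: "a \<in> cocycles A k" "X = coset A k a" using X(1) by (auto simp: cgr_cohom)
  obtain b where b: "b \<in> cocycles A (?N - k)" "Y = coset A (?N - k) b"
    using Y(1) by (auto simp: cgr_cohom)
  obtain i where i: "k = Suc i" using k gr0_conv_Suc by blast
  have ab_closed: "cmu A k (?N - k) a b \<in> cgr A ?N"
    using cocyclesD(1)[OF a(1)] cocyclesD(1)[OF b(1)] k_le by simp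
  define e where "e = cad A ?N (cmu A k (?N - k) a b) (csc A ?N (-1) \<omega>)"
  have "coset A ?N (cmu A k (?N - k) a b) = ?c"
    using Y(2) k_le cmu_cohom[OF a(1) b(1)] unfolding a(2) b(2) by simp
  then have e: "e \<in> coboundaries A ?N"
    unfolding e_def using coset_eq_iff[OF ab_closed assms(6)] by simp
  have ab: "cmu A k (?N - k) a b = cad A ?N \<omega> e"
    unfolding e_def using ab_closed assms(6) by (simp add: add_diff_cancel)
  \<comment> \<open>\<open>massey_division\<close> read in cohomology: a class killed by
    \<open>Y\<close> is divisible by \<open>X\<close>, and is zero in degree \<open>k\<close>. The
    element obtained there satisfies \<open>z + a w\<close> exact, hence the sign in
    \<open>?w\<close>.\<close>
  have division: "\<exists>W\<in>cgr ?H r. Z = cmu ?H k r X W \<and> (r = 0 \<longrightarrow> Z = czr ?H (k + r))"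
    if Z: "Z \<in> cgr ?H (k + r)" and YZ: "cmu ?H (?N - k) (k + r) Y Z = czr ?H (?N + r)" for Z r
  proof -
    obtain z where z: "z \<in> cocycles A (k + r)" "Z = coset A (k + r) z" using Z by (auto simp: cgr_cohom)
    have deg: "?N - k + (k + r) = ?N + r" using k_le by simp
    have "cmu A (?N - k) (k + r) b z \<in> cgr A (?N + r)"
      using cocyclesD(1)[OF b(1)] cocyclesD(1)[OF z(1)] deg by simp
    moreover have "coset A (?N + r) (cmu A (?N - k) (k + r) b z) = coset A (?N + r) (czr A (?N + r))"
      using YZ cmu_cohom[OF b(1) z(1)] deg unfolding b(2) z(2) czr_cohom by simp
    ultimately have bz: "cmu A (?N - k) (k + r) b z \<in> coboundaries A (?N + r)"
      by (simp add: coset_eq_zero_iff)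
    have "Suc i + (?N - k) = ?N" "Suc (i + (?N - k) + r) = ?N + r" using i k_le by simp_all
    then obtain w where w: "w \<in> cocycles A r"
      "cad A (Suc (i + r)) z (cmu A (Suc i) r a w) \<in> coboundaries A (Suc (i + r))"
      "r = 0 \<Longrightarrow> w = czr A 0"
      using massey_division[OF massey connected_cocycles[OF assms(5)] omega_nontrivial,
        of a i b "?N - k" z r e] a(1) b(1) z(1) e ab bz unfolding i by auto
    note mem = cocyclesD(1)[OF w(1)] cocyclesD(1)[OF a(1)] cocyclesD(1)[OF z(1)]
    let ?w = "csc A r (-1) w"
    have "cmu A k r a ?w = csc A (k + r) (-1) (cmu A k r a w)" using mem by simp
    then have "coset A (k + r) z = coset A (k + r) (cmu A k r a ?w)"
      using mem w(2) unfolding i by (subst coset_eq_iff) simp_all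
    then have "Z = cmu ?H k r X (coset A r ?w)"
      using a z w(1) by (simp add: cmu_cohom)
    moreover have "coset A r ?w \<in> cgr ?H r" using w(1) by (simp add: cgr_cohom)
    moreover have "Z = czr ?H (k + r)" if "r = 0"
      using \<open>coset A (k + r) z = _\<close> w(3)[OF that] mem z(2) that by (simp add: czr_cohom)
    ultimately show ?thesis by blast
  qed
  have generated: "\<exists>W\<in>cgr ?H (d - k). Z = cmu ?H k (d - k) X W" if d: "k \<le> d" and Z: "Z \<in> cgr ?H d" for d Z
  proof (cases "d = k")
    case True
    let ?YX = "cmu ?H (?N - k) k Y X" and ?YZ = "cmu ?H (?N - k) k Y Z"
    have mem: "?YX \<in> cgr ?H ?N" "?YZ \<in> cgr ?H ?N" using X Y Z True k_le by simp_all
    \<comment> \<open>Up to sign \<open>?YX\<close> is \<open>?c\<close>, by graded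
      commutativity.\<close>
    have "\<alpha> ?YX \<noteq> 0"
    proof
      assume "\<alpha> ?YX = 0"
      then have "?YX = czr ?H ?N" using \<alpha>_inj mem by blast
      then have "?c = czr ?H ?N" using H.mult_comm[OF X(1) Y(1)] Y(2) k_le by simp
      then show False using c_ne by simp
    qed
    \<comment> \<open>Chosen so that \<open>Y (Z - s X)\<close> has \<alpha>-value zero, hence is
      zero; the case \<open>r = 0\<close> of \<open>division\<close> then gives
      \<open>Z = s X\<close>.\<close>
    define s where "s = \<alpha> ?YZ / \<alpha> ?YX"
    let ?Z = "cad ?H k Z (csc ?H k (-s) X)"
    have Z': "?Z \<in> cgr ?H (k + 0)" using Z True X by simp
    have YZ': "cmu ?H (?N - k) k Y ?Z = cad ?H ?N ?YZ (csc ?H ?N (-s) ?YX)"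
      using X Y(1) Z True k_le by (simp add: H.mult_add_right)
    have "\<alpha> (cad ?H ?N ?YZ (csc ?H ?N (-s) ?YX)) = 0"
      using mem \<open>\<alpha> ?YX \<noteq> 0\<close> by (simp add: \<alpha>_add \<alpha>_scale s_def)
    then have "cad ?H ?N ?YZ (csc ?H ?N (-s) ?YX) = czr ?H ?N"
      using mem by (intro \<alpha>_inj) simp_all
    then have "cmu ?H (?N - k) (k + 0) Y ?Z = czr ?H (?N + 0)" using YZ' by simp
    from division[OF Z' this] have "?Z = czr ?H k" by simp
    then have "Z = csc ?H k s X"
      using H.add_eq_iff[of Z k "csc ?H k (-s) X" "czr ?H k"] Z True X by simp
    then have "Z = cmu ?H k 0 X (csc ?H 0 s (cun ?H))" using X by simp
    then show ?thesis using True by (intro bexI[of _ "csc ?H 0 s (cun ?H)"]) auto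
  next
    case False
    then obtain r where r: "d = k + r" "0 < r" using d le_Suc_ex[of k d] by auto
    have "cmu ?H (?N - k) (k + r) Y Z \<in> cgr ?H (?N + r)" using Y(1) Z r k_le by simp
    \<comment> \<open>For \<open>r > 0\<close> the product with \<open>Y\<close> lies above the top
      degree.\<close>
    then have "cmu ?H (?N - k) (k + r) Y Z = czr ?H (?N + r)" using above[of "?N + r"] r by simp
    from division[OF _ this] show ?thesis using Z r by auto
  qed
  interpret monogenic ?H k ?N X
    by unfold_locales (use k X unit above gap generated in \<open>auto simp: cdf_cohom\<close>)
  show ?thesis using iso_trunc_poly by blast
qed

end
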